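(* Let $\Bbbk$ be an algebraically closed field of characteristic zero, let $n\ge2$, let $c(x)\in\Bbbk[x]$ be centered of degree $n$, and let $q(x,y)=\lambda y^2+p(x)$ with $\lambda\in\Bbbk^*$ and $p(x)=p_0+p_1x+\cdots+p_{n-1}x^{n-1}\in\Bbbk[x]$. Suppose that $p_0p_1\neq0$. Then every simple derivation $D\in\operatorname{Der}_{\Bbbk}(A_{c,q})$ satisfies $\operatorname{Aut}_D(A_{c,q})=\{\operatorname{id}\}$.
   Context: $A_{c,q}=\Bbbk[x,y,z]/(c(x)z-q(x,y))$. The polynomial $c$ of degree $n$ is centered if the coefficient of $x^{n-1}$ in $c$ is zero. $\operatorname{Der}_{\Bbbk}(A)$ is the space of $\Bbbk$-derivations of $A$; a derivation $D$ of $A$ is simple if the only ideals $I\subseteq A$ with $D(I)\subseteq I$ are $0$ and $A$; $\operatorname{Aut}_D(A)$ is the group of $\Bbbk$-algebra automorphisms $\sigma$ of $A$ with $\sigma D=D\sigma$. *)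

theory Defs
  imports "HOL-Algebra.Algebraic_Closure_Type"
begin

text \<open>
  A \<open>\<k>\<close>-algebra is a ring \<open>A\<close> together with its structure map \<open>\<phi>\<close> from \<open>\<k>\<close> (a type) to \<open>A\<close>.
  Endomaps of \<open>A\<close> are extensional, so that equality of maps is equality on \<^term>\<open>carrier A\<close>.
\<close>

definition derivations :: "('k \<Rightarrow> 'b) \<Rightarrow> ('b, 'm) ring_scheme \<Rightarrow> ('b \<Rightarrow> 'b) set" where
  "derivations \<phi> A = {D \<in> carrier A \<rightarrow>\<^sub>E carrier A.
     (\<forall>f\<in>carrier A. \<forall>g\<in>carrier A. D (f \<oplus>\<^bsub>A\<^esub> g) = D f \<oplus>\<^bsub>A\<^esub> D g) \<and>
     (\<forall>a. \<forall>f\<in>carrier A. D (\<phi> a \<otimes>\<^bsub>A\<^esub> f) = \<phi> a \<otimes>\<^bsub>A\<^esub> D f) \<and>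
     (\<forall>f\<in>carrier A. \<forall>g\<in>carrier A.
        D (f \<otimes>\<^bsub>A\<^esub> g) = D f \<otimes>\<^bsub>A\<^esub> g \<oplus>\<^bsub>A\<^esub> f \<otimes>\<^bsub>A\<^esub> D g)}"

definition simple_derivation :: "('b, 'm) ring_scheme \<Rightarrow> ('b \<Rightarrow> 'b) \<Rightarrow> bool" where
  "simple_derivation A D \<longleftrightarrow>
     (\<forall>I. ideal I A \<and> D ` I \<subseteq> I \<longrightarrow> I = {\<zero>\<^bsub>A\<^esub>} \<or> I = carrier A)"

definition algebra_auts :: "('k \<Rightarrow> 'b) \<Rightarrow> ('b, 'm) ring_scheme \<Rightarrow> ('b \<Rightarrow> 'b) set" where
  "algebra_auts \<phi> A = {\<sigma> \<in> ring_iso A A \<inter> extensional (carrier A). \<forall>a. \<sigma> (\<phi> a) = \<phi> a}"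

definition derivation_auts ::
    "('k \<Rightarrow> 'b) \<Rightarrow> ('b, 'm) ring_scheme \<Rightarrow> ('b \<Rightarrow> 'b) \<Rightarrow> ('b \<Rightarrow> 'b) set" where
  "derivation_auts \<phi> A D =
     {\<sigma> \<in> algebra_auts \<phi> A. compose (carrier A) \<sigma> D = compose (carrier A) D \<sigma>}"

text \<open>
  The polynomial ring \<open>\<k>[x,y,z]\<close> is realised as \<open>\<k>[x][y][z]\<close>: the innermost variable is \<open>x\<close>,
  the outermost is \<open>z\<close>. Thus \<^term>\<open>[:[:c:]:]\<close> is \<open>c(x)\<close>, \<^term>\<open>[:q:]\<close> is \<open>q(x,y)\<close> for
  \<open>q \<in> \<k>[x][y]\<close>, and \<^term>\<open>[:0, 1:]\<close> is \<open>z\<close>.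
\<close>

abbreviation poly3_ring :: "'k::comm_ring_1 poly poly poly ring" where
  "poly3_ring \<equiv> ring_of_type_algebra"

definition danielewski_ideal ::
    "'k::comm_ring_1 poly \<Rightarrow> 'k poly poly \<Rightarrow> 'k poly poly poly set" where
  "danielewski_ideal c q = Idl\<^bsub>poly3_ring\<^esub> {[:[:c:]:] * [:0, 1:] - [:q:]}"

definition danielewski ::
    "'k::comm_ring_1 poly \<Rightarrow> 'k poly poly \<Rightarrow> 'k poly poly poly set ring" where
  "danielewski c q = poly3_ring Quot danielewski_ideal c q"

definition danielewski_const ::
    "'k::comm_ring_1 poly \<Rightarrow> 'k poly poly \<Rightarrow> 'k \<Rightarrow> 'k poly poly poly set" where
  "danielewski_const c q a = danielewski_ideal c q +>\<^bsub>poly3_ring\<^esub> [:[:[:a:]:]:]"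

text \<open>Meaningful for positive degree only, because of the truncated subtraction.\<close>

definition centered :: "'k::zero poly \<Rightarrow> bool" where
  "centered c \<longleftrightarrow> poly.coeff c (Polynomial.degree c - 1) = 0"

lemma danielewski_ideal_ideal: "ideal (danielewski_ideal c q) poly3_ring"
  unfolding danielewski_ideal_def
  by (rule ring.genideal_ideal[OF ring_from_type_algebra])
    (simp add: ring_of_type_algebra_def)

lemma cring_danielewski: "cring (danielewski c q)"
  unfolding danielewski_def
  by (rule ideal.quotient_is_cring[OF danielewski_ideal_ideal cring_from_type_algebra])

lemma danielewski_const_hom: "danielewski_const c q \<in> ring_hom ring_of_type_algebra (danielewski c q)"
proof -
  have "(\<lambda>a. [:[:[:a:]:]:]) \<in> ring_hom ring_of_type_algebra (poly3_ring :: 'a poly poly poly ring)"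
    by (rule ring_hom_memI) (simp_all add: ring_of_type_algebra_def one_pCons)
  from ring_hom_trans[OF this ideal.rcos_ring_hom[OF danielewski_ideal_ideal]]
  show ?thesis
    by (simp add: danielewski_def danielewski_const_def[abs_def] comp_def)
qed

end

theory Submission
  imports Defs
begin

text \<open>
  Write \<open>B\<close> for the ring \<open>A\<^sub>c\<^sub>,\<^sub>q\<close> of the surface \<open>c(x) z = \<lambda> y\<^sup>2 + p(x)\<close>, with
  \<open>l\<close> for \<open>\<lambda>\<close> in the formulas. Solving for \<open>z\<close> realises \<open>B\<close>
  as a subring of \<open>k((1/x))[y]\<close>, where every nonzero element has a leading term \<open>x\<^sup>i y\<^sup>j\<close> with integers \<open>i\<close> and
  \<open>j \<ge> 0\<close>. The surface carries the Poisson bracket \<open>{f, g} = c (f\<^sub>x g\<^sub>y - f\<^sub>y g\<^sub>x)\<close>, which is regular on \<open>B\<close>.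

  Let \<open>\<sigma>\<close> commute with the simple derivation \<open>D\<close>. The Jacobian ideal of the surface is stable under
  every derivation, so the simplicity of \<open>D\<close> makes it the unit ideal (\<open>jacobian_unit_ideal\<close>); in other
  words the surface is smooth. Then every alternating biderivation of \<open>B\<close> is the bracket times an
  element of \<open>B\<close>, and \<open>\<sigma>\<close> transports the bracket to a constant multiple of itself, because the units of \<open>B\<close> are
  constants (\<open>automorphism_scales_bracket\<close>).

  The derivation \<open>{x, _} = c \<partial>/\<partial>y\<close> is locally nilpotent, hence so is \<open>{\<sigma> x, _}\<close>. If \<open>\<sigma> x\<close> involved \<open>y\<close>, a
  computation with leading terms, in which \<open>n \<ge> 2\<close> enters, would show that no iterate of
  \<open>{\<sigma> x, _}\<close> kills \<open>x\<close> (\<open>bracket_orbit_nonzero\<close>). So \<open>\<sigma>\<close> maps \<open>k[x]\<close> to itself and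
  \<open>\<sigma> x = \<alpha> x + \<beta>\<close>. The surface equation then leaves few possibilities: \<open>c(\<alpha> x + \<beta>)\<close> is proportional to
  the centered polynomial \<open>c\<close>, so \<open>\<beta> = 0\<close>; \<open>\<sigma> y = \<epsilon> y + b(x)\<close> with \<open>c\<close> dividing \<open>b\<close>; and
  \<open>p(\<alpha> x) = \<epsilon>\<^sup>2 p(x)\<close>, whose first two coefficients give \<open>\<epsilon>\<^sup>2 = 1\<close> and \<open>\<alpha> = 1\<close>
  (\<open>automorphism_form\<close>).

  Simplicity excludes what remains. If \<open>\<epsilon> = -1\<close>, the element \<open>2 y - b\<close>, which vanishes on the fixed curve
  of \<open>\<sigma>\<close>, generates a \<open>D\<close>-stable ideal (\<open>no_reflection\<close>). If \<open>\<epsilon> = 1\<close> and \<open>b \<noteq> 0\<close>, then \<open>D x\<close> is invariant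
  under the translation \<open>y \<mapsto> y + b\<close>, so it is a polynomial in \<open>x\<close>, and without root by simplicity;
  then \<open>D y = g\<^sub>0 + g\<^sub>1 y\<close> with \<open>g\<^sub>1 b\<close> a nonzero multiple of \<open>b'\<close>, which is impossible for
  degree reasons (\<open>no_translation\<close>).
\<close>

section \<open>Polynomials and their derivations\<close>

unbundle fps_syntax

abbreviation deg :: "'a::zero poly \<Rightarrow> nat" where "deg \<equiv> Polynomial.degree"
abbreviation cf :: "'a::zero poly \<Rightarrow> nat \<Rightarrow> 'a" where "cf \<equiv> poly.coeff"
abbreviation lead :: "'a::zero poly \<Rightarrow> 'a" where "lead f \<equiv> cf f (deg f)"

definition derivation :: "('a::comm_ring_1 \<Rightarrow> 'a) \<Rightarrow> bool" where
  "derivation d \<longleftrightarrow> (\<forall>f g. d (f + g) = d f + d g) \<and> (\<forall>f g. d (f * g) = d f * g + f * d g)"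

lemma derivationI:
  assumes "\<And>f g. d (f + g) = d f + d g" "\<And>f g. d (f * g) = d f * g + f * d g"
  shows "derivation d"
  using assms by (simp add: derivation_def)

lemma derivation_add: "derivation d \<Longrightarrow> d (f + g) = d f + d g"
  and derivation_mult: "derivation d \<Longrightarrow> d (f * g) = d f * g + f * d g"
  by (simp_all add: derivation_def)

lemma derivation_0: "derivation d \<Longrightarrow> d 0 = 0"
  using derivation_add[of d 0 0] by simp

lemma derivation_sum: "derivation d \<Longrightarrow> d (sum f S) = (\<Sum>i\<in>S. d (f i))"
  by (induction S rule: infinite_finite_induct) (auto simp: derivation_0 derivation_add)

lemma derivation_pderiv: "derivation (pderiv :: 'a::idom poly \<Rightarrow> _)"
  by (rule derivationI) (simp_all add: pderiv_add pderiv_mult)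

lemma derivation_map_poly:
  assumes d: "derivation d"
  shows "derivation (map_poly d)"
proof (rule derivationI)
  show "map_poly d (f + g) = map_poly d f + map_poly d g" for f g
    by (rule poly_eqI) (simp add: coeff_map_poly derivation_0[OF d] derivation_add[OF d])
  show "map_poly d (f * g) = map_poly d f * g + f * map_poly d g" for f g
    by (rule poly_eqI)
      (simp add: coeff_map_poly derivation_0[OF d] derivation_sum[OF d] coeff_mult
        derivation_mult[OF d] sum.distrib)
qed

text \<open>
  Bounds instead of exact degrees: derivatives may lose their top coefficient.
\<close>

lemma coeff_mult_top:
  fixes f g :: "'a::comm_ring_1 poly"
  assumes "deg f \<le> m" "deg g \<le> k"
  shows "cf (f * g) (m + k) = cf f m * cf g k"
proof -
  have "cf (f * g) (m + k) = (\<Sum>i\<le>m+k. cf f i * cf g (m + k - i))"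
    by (simp add: coeff_mult)
  also have "\<dots> = (\<Sum>i\<le>m+k. if i = m then cf f m * cf g k else 0)"
  proof (rule sum.cong[OF refl])
    fix i assume i: "i \<in> {..m+k}"
    consider "i < m" | "i = m" | "i > m" by linarith
    then show "cf f i * cf g (m + k - i) = (if i = m then cf f m * cf g k else 0)"
    proof cases
      case 1
      then have "deg g < m + k - i" using assms by linarith
      with 1 show ?thesis by (simp add: coeff_eq_0)
    next
      case 3
      then have "deg f < i" using assms by linarith
      with 3 show ?thesis by (simp add: coeff_eq_0)
    qed auto
  qed
  also have "\<dots> = cf f m * cf g k" by simp
  finally show ?thesis .
qed

text \<open>
  This coefficient detects a translation: it is used for \<open>c(\<alpha> x + \<beta>)\<close> as well as for \<open>f(y + b)\<close>.
\<close>

lemma coeff_pcompose_subleading: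
  fixes f :: "'a::comm_ring_1 poly"
  assumes "deg f \<le> Suc N"
  shows "cf (pcompose f [:\<beta>, \<alpha>:]) N = \<alpha> ^ N * (cf f N + of_nat (Suc N) * \<beta> * cf f (Suc N))"
  using assms
proof (induction f arbitrary: N)
  case (pCons a g)
  show ?case
  proof (cases N)
    case 0
    then have "deg g = 0" using pCons.prems by (auto split: if_splits)
    then obtain b where "g = [:b:]" by (rule degree_eq_zeroE)
    then show ?thesis using 0 by (simp add: pcompose_pCons mult_pCons_left)
  next
    case (Suc M)
    have "deg g \<le> Suc M" using pCons.prems Suc by (auto split: if_splits)
    have "cf (pcompose g [:\<beta>, \<alpha>:]) M = \<alpha> ^ M * (cf g M + of_nat (Suc M) * \<beta> * cf g (Suc M))"
      and "cf (pcompose g [:\<beta>, \<alpha>:]) (Suc M) = \<alpha> ^ Suc M * (cf g (Suc M) + of_nat (Suc (Suc M)) * \<beta> * cf g (Suc (Suc M)))"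
      using pCons.IH[of M] pCons.IH[of "Suc M"] \<open>deg g \<le> Suc M\<close> by (simp_all only: le_SucI)
    moreover have "cf g (Suc (Suc M)) = 0" using \<open>deg g \<le> Suc M\<close> by (intro coeff_eq_0) simp
    ultimately show ?thesis
      by (simp add: Suc pcompose_pCons mult_pCons_left algebra_simps)
  qed
qed simp

lemma pcompose_translation_fixed:
  fixes f :: "'a::{idom, ring_char_0} poly"
  assumes "pcompose f [:b, 1:] = f + [:r:]" "b \<noteq> 0"
  shows "deg f \<le> 1" and "r = 0 \<Longrightarrow> deg f = 0"
proof -
  have *: "N = 0 \<and> r \<noteq> 0" if "deg f = Suc N" for N
  proof -
    have "cf f (Suc N) \<noteq> 0" using that by (metis leading_coeff_0_iff degree_0 nat.distinct(1))
    moreover have "cf (f + [:r:]) N = cf f N + of_nat (Suc N) * b * cf f (Suc N)"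
      using coeff_pcompose_subleading[of f N b 1] that assms(1) by simp
    ultimately have "cf [:r:] N \<noteq> 0" using assms(2) by (simp del: of_nat_Suc)
    then show ?thesis by (cases N) auto
  qed
  show "deg f \<le> 1" using * by (cases "deg f") auto
  show "r = 0 \<Longrightarrow> deg f = 0" using * by (cases "deg f") auto
qed

section \<open>Laurent series in 1/x\<close>

text \<open>
  The variable of the Laurent series stands for \<open>1/x\<close>, so that the negative of the subdegree is the
  degree in \<open>x\<close>, and \<open>iota\<close> is the embedding of \<open>k[x]\<close>.
\<close>

definition iota :: "'k::field poly \<Rightarrow> 'k fls" where
  "iota p = poly (map_poly fls_const p) fls_X_inv"

lemma iota_0 [simp]: "iota 0 = 0" by (simp add: iota_def)
lemma iota_pCons: "iota (pCons a p) = fls_const a + fls_X_inv * iota p"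
  by (simp add: iota_def map_poly_pCons)
lemma iota_add [simp]: "iota (f + g) = iota f + iota g"
  by (induction f g rule: poly_induct2) (simp_all add: iota_pCons algebra_simps fls_plus_const)
lemma iota_smult [simp]: "iota (smult a f) = fls_const a * iota f"
  by (induction f) (simp_all add: iota_pCons algebra_simps fls_const_mult_const)
lemma iota_mult [simp]: "iota (f * g) = iota f * iota g"
  by (induction f) (simp_all add: iota_pCons algebra_simps)
lemma iota_1 [simp]: "iota 1 = 1" by (simp add: one_pCons iota_pCons)
lemma iota_minus [simp]: "iota (- f) = - iota f"
  using iota_add[of f "-f"] by (simp add: eq_neg_iff_add_eq_0 add.commute del: iota_add)
lemma iota_diff [simp]: "iota (f - g) = iota f - iota g"
  using iota_add[of f "-g"] by simp

lemma iota_numeral_2: "iota 2 = 2"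
  using iota_add[of 1 1] by simp

lemma iota_nth: "iota f $$ n = (if n \<le> 0 then cf f (nat (-n)) else 0)"
proof (induction f arbitrary: n)
  case (pCons a f)
  then show ?case
    by (auto simp: iota_pCons fls_X_inv_times_conv_shift coeff_pCons nat_eq_iff
        split: nat.splits)
qed simp

lemma iota_eq_0_iff [simp]: "iota f = 0 \<longleftrightarrow> f = 0"
proof
  assume "iota f = 0"
  then have "cf f n = 0" for n using iota_nth[of f "- int n"] by simp
  then show "f = 0" by (intro poly_eqI) simp
qed simp

lemma iota_inj: "iota f = iota g \<longleftrightarrow> f = g"
  using iota_eq_0_iff[of "f - g"] by simp

lemma subdegree_iota: "fls_subdegree (iota f) = - int (deg f)"
proof (cases "f = 0")
  case False
  then show ?thesis
    by (intro fls_subdegree_eqI) (auto simp: iota_nth coeff_eq_0)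
qed simp

text \<open>The derivation \<open>d/dx\<close>, which in terms of \<open>t = 1/x\<close> is \<open>- t\<^sup>2 d/dt\<close>.\<close>

definition dx :: "'k::field fls \<Rightarrow> 'k fls" where
  "dx f = - (fls_X\<^sup>2 * fls_deriv f)"

lemma derivation_dx: "derivation dx"
  by (rule derivationI) (simp_all add: dx_def algebra_simps)

lemma dx_const [simp]: "dx (fls_const a) = 0" "dx 0 = 0"
  by (simp_all add: dx_def)

lemma dx_X_inv [simp]: "dx fls_X_inv = 1"
proof -
  have "fls_X * fls_X_inv = (1 :: 'a fls)"
    by (simp add: fls_X_times_conv_shift)
  then show ?thesis by (simp add: dx_def flip: power_mult_distrib)
qed

lemma dx_iota [simp]: "dx (iota f) = iota (pderiv f)"
  by (induction f) (simp_all add: iota_pCons derivation_add[OF derivation_dx]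
      derivation_mult[OF derivation_dx] pderiv_pCons)

lemma dx_nth: "dx f $$ n = - (of_int (n - 1) * f $$ (n - 1))"
  by (simp add: dx_def fls_X_power_times_conv_shift)

abbreviation xdeg :: "'k::zero fls \<Rightarrow> int" where "xdeg f \<equiv> - fls_subdegree f"

text \<open>
  Lower bounds for the orders, instead of the orders themselves, cover the vanishing of a
  leading coefficient of a derivative.
\<close>

lemma fls_mult_low:
  fixes f g :: "'k::comm_ring_1 fls"
  assumes f: "\<And>i. i < a \<Longrightarrow> f $$ i = 0" and g: "\<And>i. i < b \<Longrightarrow> g $$ i = 0"
  shows "m < a + b \<Longrightarrow> (f * g) $$ m = 0" and "(f * g) $$ (a + b) = f $$ a * g $$ b"
proof -
  have "(m < a + b \<longrightarrow> (f * g) $$ m = 0) \<and> (f * g) $$ (a + b) = f $$ a * g $$ b"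
  proof (cases "f = 0 \<or> g = 0")
    case False
    then have ab: "a \<le> fls_subdegree f" "b \<le> fls_subdegree g"
      using f g nth_fls_subdegree_nonzero by (metis not_le)+
    show ?thesis
    proof (cases "a = fls_subdegree f \<and> b = fls_subdegree g")
      case True
      then show ?thesis by (auto simp: fls_times_nth_eq0)
    next
      case False
      with ab have "a + b < fls_subdegree f + fls_subdegree g" "f $$ a = 0 \<or> g $$ b = 0"
        by auto
      then show ?thesis by (auto simp: fls_times_nth_eq0)
    qed
  qed auto
  then show "m < a + b \<Longrightarrow> (f * g) $$ m = 0" "(f * g) $$ (a + b) = f $$ a * g $$ b" by auto
qed

text \<open>
  Leading terms \<open>x\<^sup>i\<close> and \<open>x\<^sup>a\<close> contribute \<open>(i b - j a) x\<^sup>i\<^sup>+\<^sup>a\<^sup>-\<^sup>1\<close>; characteristic zero is what keeps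
  this factor nonzero in \<open>k\<close>.
\<close>

lemma wronskian_subdegree:
  fixes f g :: "'k::field_char_0 fls"
  assumes "f \<noteq> 0" "g \<noteq> 0"
    and ne: "xdeg f * b - j * xdeg g \<noteq> 0"
  shows "of_int b * (dx f * g) - of_int j * (f * dx g) \<noteq> 0"
    and "xdeg (of_int b * (dx f * g) - of_int j * (f * dx g)) = xdeg f + xdeg g - 1"
proof -
  define h where "h = of_int b * (dx f * g) - of_int j * (f * dx g)"
  let ?s = "fls_subdegree f" and ?t = "fls_subdegree g"
  have dxz: "dx u $$ m = 0" if "m < fls_subdegree u + 1" for m and u :: "'k fls"
    using that by (simp add: dx_nth)
  have coeff: "(of_int i * u) $$ m = of_int i * u $$ m" for i m and u :: "'k fls"
    by (simp add: fls_of_int)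
  have low: "h $$ m = 0" if "m < ?s + ?t + 1" for m
    using that fls_mult_low(1)[of "?s + 1" "dx f" ?t g m] fls_mult_low(1)[of ?s f "?t + 1" "dx g" m]
    by (simp add: h_def coeff dxz)
  have "h $$ (?s + ?t + 1) = of_int (xdeg f * b - j * xdeg g) * (f $$ ?s * g $$ ?t)"
  proof -
    have "(dx f * g) $$ (?s + ?t + 1) = dx f $$ (?s + 1) * g $$ ?t"
      using fls_mult_low(2)[of "?s + 1" "dx f" ?t g] by (simp add: dxz add.commute add.left_commute)
    moreover have "(f * dx g) $$ (?s + ?t + 1) = f $$ ?s * dx g $$ (?t + 1)"
      using fls_mult_low(2)[of ?s f "?t + 1" "dx g"] by (simp add: dxz add.assoc)
    ultimately show ?thesis
      unfolding h_def fls_minus_nth coeff by (simp add: dx_nth) (simp add: algebra_simps)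
  qed
  with assms have nz: "h $$ (?s + ?t + 1) \<noteq> 0"
    by (simp del: of_int_diff of_int_mult)
  then show "h \<noteq> 0" by auto
  have "fls_subdegree h = ?s + ?t + 1"
    using nz low by (rule fls_subdegree_eqI)
  then show "xdeg h = xdeg f + xdeg g - 1" by simp
qed

section \<open>Leading terms of Jacobian determinants\<close>

text \<open>
  In \<open>k((1/x))[y]\<close> the coefficientwise \<open>dx\<close> is \<open>\<partial>/\<partial>x\<close>, and \<open>pderiv\<close> is \<open>\<partial>/\<partial>y\<close>.
\<close>

definition jac :: "'k::field fls poly \<Rightarrow> 'k fls poly \<Rightarrow> 'k fls poly" where
  "jac f g = map_poly dx f * pderiv g - pderiv f * map_poly dx g"

lemma coeff_y_pderiv: "cf ([:0, 1:] * pderiv f) n = of_nat n * cf f n"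
  by (cases n) (simp_all add: coeff_pderiv)

lemma degree_y_pderiv_le: "deg ([:0, 1:] * pderiv f) \<le> deg f"
  by (rule degree_le) (use coeff_y_pderiv[of f] coeff_eq_0[of f] in auto)

text \<open>
  For leading terms \<open>x\<^sup>i y\<^sup>j\<close> and \<open>x\<^sup>a y\<^sup>b\<close> (first by the degree in \<open>y\<close>, then in \<open>x\<close>) the leading term of the
  Jacobian is \<open>(i b - j a) x\<^sup>i\<^sup>+\<^sup>a\<^sup>-\<^sup>1 y\<^sup>j\<^sup>+\<^sup>b\<^sup>-\<^sup>1\<close>, unless the two exponents are proportional.
\<close>

lemma jac_lead:
  fixes f g :: "'k::field_char_0 fls poly"
  assumes "f \<noteq> 0" "g \<noteq> 0"
    and ne: "xdeg (lead f) * int (deg g) - int (deg f) * xdeg (lead g) \<noteq> 0"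
  shows "jac f g \<noteq> 0"
    and "int (deg (jac f g)) = int (deg f) + int (deg g) - 1"
    and "xdeg (lead (jac f g)) = xdeg (lead f) + xdeg (lead g) - 1"
proof -
  \<comment> \<open>multiplied by \<open>y\<close>, since \<open>y \<partial>/\<partial>y\<close> multiplies the coefficient at \<open>y\<^sup>m\<close> by \<open>m\<close>, also for \<open>m = 0\<close>\<close>
  define h where "h = [:0, 1:] * jac f g"
  let ?j = "deg f" and ?b = "deg g"
  let ?y = "[:0, 1:] :: 'k fls poly"
  have h: "h = map_poly dx f * (?y * pderiv g) - (?y * pderiv f) * map_poly dx g"
    by (simp only: h_def jac_def) (simp only: algebra_simps)
  have le1: "deg (map_poly dx u) \<le> deg u" for u :: "'k fls poly"
    by (rule degree_le) (simp add: coeff_map_poly coeff_eq_0)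
  note le = le1 degree_y_pderiv_le
  have dh: "deg h \<le> ?j + ?b"
    unfolding h by (intro degree_diff_le order.trans[OF degree_mult_le] add_mono le)
  have top: "cf h (?j + ?b) =
      of_int (int ?b) * (dx (lead f) * lead g) - of_int (int ?j) * (lead f * dx (lead g))"
    unfolding h coeff_diff coeff_mult_top[OF le] coeff_mult_top[OF le(2,1)] coeff_y_pderiv
    by (simp add: coeff_map_poly)
  have nz: "cf h (?j + ?b) \<noteq> 0"
    unfolding top using assms by (intro wronskian_subdegree) auto
  then have "deg h = ?j + ?b" using dh le_degree by (metis le_antisym)
  moreover have h': "h = pCons 0 (jac f g)" by (simp add: h_def)
  moreover have "jac f g \<noteq> 0" using nz h' by auto
  ultimately have d: "deg h = Suc (deg (jac f g))" "jac f g \<noteq> 0" by auto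
  then show "jac f g \<noteq> 0" by simp
  show "int (deg (jac f g)) = int ?j + int ?b - 1" using d \<open>deg h = ?j + ?b\<close> by simp
  have "lead (jac f g) = cf h (?j + ?b)"
    using d(1) unfolding \<open>deg h = ?j + ?b\<close> by (simp add: h')
  then show "xdeg (lead (jac f g)) = xdeg (lead f) + xdeg (lead g) - 1"
    unfolding top using wronskian_subdegree(2)[of "lead f" "lead g" "int ?b" "int ?j"] assms by simp
qed

section \<open>The surface as a subring of k((1/x))[y]\<close>

abbreviation K :: "'k::field \<Rightarrow> 'k fls poly" where "K a \<equiv> [:fls_const a:]"
abbreviation emb :: "'k::field poly \<Rightarrow> 'k fls poly" where "emb f \<equiv> [:iota f:]"
abbreviation yy :: "'k::field fls poly" where "yy \<equiv> [:0, 1:]"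

lemma K_emb: "K a = emb [:a:]" by (simp add: iota_pCons)

lemma K_mult: "K (a * b) = K a * K b"
  by (simp add: fls_const_mult_const mult.commute)

locale surface =
  fixes c p :: "'k::field_char_0 poly" and l :: 'k
  assumes deg_c: "deg c \<ge> 2" and l: "l \<noteq> 0"
begin

definition zz :: "'k fls poly" where
  "zz = [: iota p / iota c, 0, fls_const l / iota c :]"

text \<open>The value \<open>g(x, z)\<close> of \<open>g \<in> k[x][z]\<close>.\<close>

definition ev :: "'k poly poly \<Rightarrow> 'k fls poly" where
  "ev g = pcompose (map_poly iota g) zz"

text \<open>
  The coordinate ring, given by normal forms \<open>g(x, z) + h(x, z) y\<close>: powers \<open>y\<^sup>2\<close> can be removed because
  \<open>\<lambda> y\<^sup>2 = c z - p\<close>. Degrees in \<open>y\<close> and the surface equation are visible in this form at once.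
\<close>

definition B :: "'k fls poly set" where
  "B = {ev g + ev h * yy | g h. True}"

lemma c_nz [simp]: "c \<noteq> 0" using deg_c by auto

lemma surface_eq: "emb c * zz = K l * yy\<^sup>2 + emb p"
  by (simp add: zz_def power2_eq_square)

lemma ev_0 [simp]: "ev 0 = 0" by (simp add: ev_def)
lemma ev_pCons: "ev (pCons a g) = emb a + zz * ev g"
  by (simp add: ev_def map_poly_pCons pcompose_pCons)
lemma ev_add [simp]: "ev (f + g) = ev f + ev g"
  by (induction f g rule: poly_induct2) (simp_all add: ev_pCons algebra_simps)
lemma ev_smult [simp]: "ev (smult a f) = emb a * ev f"
  by (induction f) (simp_all add: ev_pCons algebra_simps)
lemma ev_mult [simp]: "ev (f * g) = ev f * ev g"
  by (induction f) (simp_all add: ev_pCons algebra_simps)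
lemma ev_const [simp]: "ev [:a:] = emb a" by (simp add: ev_pCons)
lemma ev_1 [simp]: "ev 1 = 1" using ev_const[of 1] by (simp only: iota_1 flip: one_pCons)
lemma ev_z [simp]: "ev [:0, 1:] = zz" by (simp add: ev_pCons flip: one_pCons)
lemma ev_minus [simp]: "ev (- f) = - ev f"
  using ev_add[of f "-f"] by (simp add: eq_neg_iff_add_eq_0 add.commute del: ev_add)
lemma ev_diff [simp]: "ev (f - g) = ev f - ev g"
  using ev_add[of f "-g"] by simp

lemma BI: "ev g + ev h * yy \<in> B" by (auto simp: B_def)
lemma B_emb [simp, intro]: "emb f \<in> B" using BI[of "[:f:]" 0] by simp
lemma B_K [simp, intro]: "K a \<in> B" by (simp add: K_emb)
lemma B_ev [simp, intro]: "ev g \<in> B" using BI[of g 0] by simp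
lemma B_0 [simp, intro]: "0 \<in> B" using B_emb[of 0] by simp
lemma B_1 [simp, intro]: "1 \<in> B" using B_ev[of 1] by simp
lemma B_yy [simp, intro]: "yy \<in> B" using BI[of 0 1] by simp
lemma B_zz [simp, intro]: "zz \<in> B" using BI[of "[:0,1:]" 0] by simp

lemma B_add [intro]: "f \<in> B \<Longrightarrow> g \<in> B \<Longrightarrow> f + g \<in> B"
proof -
  assume "f \<in> B" "g \<in> B"
  then obtain a b a' b' where "f = ev a + ev b * yy" "g = ev a' + ev b' * yy" by (auto simp: B_def)
  then have "f + g = ev (a + a') + ev (b + b') * yy" by (simp only: ev_add algebra_simps)
  then show ?thesis by (metis BI)
qed

lemma yy_square: "yy\<^sup>2 = ev [: - smult (1/l) p, smult (1/l) c :]"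
proof -
  have l1: "K l * K (1/l) = 1" using l by (simp add: fls_const_mult_const one_pCons)
  have "ev [: - smult (1/l) p, smult (1/l) c :] = K (1/l) * (emb c * zz - emb p)"
    by (simp add: ev_pCons algebra_simps)
  also have "\<dots> = (K l * K (1/l)) * yy\<^sup>2" by (simp only: surface_eq) (simp only: algebra_simps)
  finally show ?thesis by (simp only: l1 mult_1_left)
qed

lemma B_mult [intro]: "f \<in> B \<Longrightarrow> g \<in> B \<Longrightarrow> f * g \<in> B"
proof -
  assume "f \<in> B" "g \<in> B"
  then obtain a b a' b' where "f = ev a + ev b * yy" "g = ev a' + ev b' * yy" by (auto simp: B_def)
  then have "f * g = (ev a * ev a' + ev b * ev b' * yy\<^sup>2) + (ev a * ev b' + ev b * ev a') * yy"
    by (simp only: power2_eq_square) (simp only: algebra_simps)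
  also have "\<dots> = ev (a * a' + b * b' * [: - smult (1/l) p, smult (1/l) c :]) + ev (a * b' + b * a') * yy"
    by (simp only: yy_square ev_mult ev_add)
  finally show ?thesis by (metis BI)
qed

lemma B_minus [intro]: "f \<in> B \<Longrightarrow> - f \<in> B"
  using B_mult[OF B_ev, of f "-1"] by simp
lemma B_diff [intro]: "f \<in> B \<Longrightarrow> g \<in> B \<Longrightarrow> f - g \<in> B"
  using B_add[of f "-g"] by auto

lemma emb_induct:
  assumes "P (emb [:0, 1:])" "\<And>a. P (K a)"
    "\<And>f g. f \<in> B \<Longrightarrow> g \<in> B \<Longrightarrow> P f \<Longrightarrow> P g \<Longrightarrow> P (f + g)"
    "\<And>f g. f \<in> B \<Longrightarrow> g \<in> B \<Longrightarrow> P f \<Longrightarrow> P g \<Longrightarrow> P (f * g)"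
  shows "P (emb f)"
proof (induction f)
  case 0
  then show ?case using assms(2)[of 0] by simp
next
  case (pCons a f)
  have "emb (pCons a f) = K a + emb [:0, 1:] * emb f" by (simp add: iota_pCons)
  then show ?case using assms pCons by (metis B_K B_emb B_mult)
qed

lemma B_induct [consumes 1, case_names const x y z add mult]:
  assumes "f \<in> B" "\<And>a. P (K a)" "P (emb [:0, 1:])" "P yy" "P zz"
    "\<And>f g. f \<in> B \<Longrightarrow> g \<in> B \<Longrightarrow> P f \<Longrightarrow> P g \<Longrightarrow> P (f + g)"
    "\<And>f g. f \<in> B \<Longrightarrow> g \<in> B \<Longrightarrow> P f \<Longrightarrow> P g \<Longrightarrow> P (f * g)"
  shows "P f"
proof -
  have e: "P (emb a)" for a by (rule emb_induct) (use assms in auto)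
  have ev: "P (ev g)" for g
    by (induction g) (use e[of 0] in \<open>auto simp: ev_pCons intro!: assms e\<close>)
  obtain g h where f: "f = ev g + ev h * yy" using assms(1) by (auto simp: B_def)
  show ?thesis unfolding f by (intro assms(2-7) ev B_mult B_ev B_yy)
qed

lemma deg_zz: "deg zz = 2" and lead_zz: "lead zz = fls_const l / iota c"
  using l by (simp_all add: zz_def)

lemma deg_ev: "deg (ev g) = 2 * deg g"
  by (simp add: ev_def degree_pcompose deg_zz degree_map_poly)

lemma lead_ev: "lead (ev g) = iota (lead g) * (fls_const l / iota c) ^ deg g"
  unfolding ev_def
  by (subst lead_coeff_comp) (simp_all only: lead_zz, simp_all add: deg_zz coeff_map_poly degree_map_poly)

lemma ev_eq_0_iff [simp]: "ev g = 0 \<longleftrightarrow> g = 0"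
proof
  assume "ev g = 0"
  then have "iota (lead g) * (fls_const l / iota c) ^ deg g = 0" using lead_ev[of g] by simp
  then show "g = 0" using l by simp
qed simp

text \<open>
  Since \<open>z\<close> has degree 2 in \<open>y\<close>, the summands \<open>g(x, z)\<close> and \<open>h(x, z) y\<close> have degrees of different parity, and
  their leading terms cannot cancel.
\<close>

lemma normal_form:
  assumes f: "f = ev g + ev h * yy"
  shows "2 * deg g \<le> deg f" and "h \<noteq> 0 \<Longrightarrow> 2 * deg h + 1 \<le> deg f"
    and "g \<noteq> 0 \<and> deg f = 2 * deg g \<and> lead f = lead (ev g)
      \<or> h \<noteq> 0 \<and> deg f = 2 * deg h + 1 \<and> lead f = lead (ev h) \<or> f = 0"
proof -
  define G H where "G = ev g" and "H = ev h * yy"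
  have fGH: "f = G + H" by (simp only: f G_def H_def)
  have H0: "H = 0 \<longleftrightarrow> h = 0" by (simp only: H_def mult_eq_0_iff) simp
  have dG: "deg G = 2 * deg g" by (simp add: G_def deg_ev)
  have dH: "h \<noteq> 0 \<Longrightarrow> deg H = 2 * deg h + 1"
    unfolding H_def by (subst degree_mult_eq) (simp_all add: deg_ev)
  have lH: "lead H = lead (ev h)"
    unfolding H_def by (subst lead_coeff_mult) simp
  have "(2 * deg g \<le> deg f \<and> (h \<noteq> 0 \<longrightarrow> 2 * deg h + 1 \<le> deg f)) \<and>
    (g \<noteq> 0 \<and> deg f = 2 * deg g \<and> lead f = lead (ev g)
      \<or> h \<noteq> 0 \<and> deg f = 2 * deg h + 1 \<and> lead f = lead (ev h) \<or> f = 0)"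
  proof (cases "h = 0")
    case True
    then have "f = G" using H0 fGH by simp
    then show ?thesis using True dG by (auto simp: G_def)
  next
    case False
    have "deg G \<noteq> deg H" unfolding dG dH[OF False] by presburger
    then consider "deg G < deg H" | "deg H < deg G" by linarith
    then show ?thesis
    proof cases
      case 1
      then have "deg f = deg H" "lead f = lead H"
        by (simp_all add: fGH degree_add_eq_right coeff_eq_0)
      then show ?thesis using 1 False dG dH lH by auto
    next
      case 2
      then have "deg f = deg G" "lead f = lead G"
        by (simp_all add: fGH degree_add_eq_left coeff_eq_0)
      then show ?thesis using 2 False dG dH by (auto simp: G_def)
    qed
  qed
  then show "2 * deg g \<le> deg f" "h \<noteq> 0 \<Longrightarrow> 2 * deg h + 1 \<le> deg f"
    "g \<noteq> 0 \<and> deg f = 2 * deg g \<and> lead f = lead (ev g)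
      \<or> h \<noteq> 0 \<and> deg f = 2 * deg h + 1 \<and> lead f = lead (ev h) \<or> f = 0" by auto
qed

lemma normal_form_unique:
  assumes "ev g + ev h * yy = 0" shows "g = 0 \<and> h = 0"
proof -
  have "h = 0" using normal_form(2)[OF assms[symmetric]] by auto
  then show ?thesis using assms by simp
qed

lemma B_deg_le_1:
  assumes "f \<in> B" "deg f \<le> 1"
  obtains a b where "f = [: iota a, iota b :]" "f = emb a + emb b * yy"
proof -
  obtain g h where f: "f = ev g + ev h * yy" using assms by (auto simp: B_def)
  have "deg g = 0" using normal_form(1)[OF f] assms(2) by auto
  then obtain a where g: "g = [:a:]" by (rule degree_eq_zeroE)
  have "deg h = 0" using normal_form(2)[OF f] assms(2) by (cases "h = 0") auto
  then obtain b where "h = [:b:]" by (rule degree_eq_zeroE)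
  with f g have "f = emb a + emb b * yy" by simp
  then show ?thesis by (intro that[of a b]) simp_all
qed

lemma B_deg_0:
  assumes "f \<in> B" "deg f = 0"
  obtains a where "f = emb a"
proof -
  obtain a b where f: "f = [: iota a, iota b :]" using B_deg_le_1 assms by (metis le0 le_trans)
  with assms(2) have "b = 0" by (auto split: if_splits)
  with f show ?thesis by (intro that[of a]) simp
qed

text \<open>
  An element of degree \<open>j\<close> in \<open>y\<close> cannot have a leading coefficient of \<open>x\<close>-degree below \<open>- j n / 2\<close>:
  denominators \<open>c\<close> come from \<open>z\<close> only, each of them together with \<open>y\<^sup>2\<close>. Here \<open>n\<close> is the degree of \<open>c\<close>.
\<close>

lemma B_weight:
  assumes "f \<in> B" "f \<noteq> 0"
  shows "2 * xdeg (lead f) + int (deg c) * int (deg f) \<ge> 0"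
proof -
  obtain g h where f: "f = ev g + ev h * yy" using assms by (auto simp: B_def)
  have *: "xdeg (lead (ev u)) = int (deg (lead u)) - int (deg c) * int (deg u)" if "u \<noteq> 0" for u
    using that l by (simp add: lead_ev fls_subdegree_pow fls_divide_subdegree subdegree_iota)
  show ?thesis using normal_form(3)[OF f] assms(2) *[of g] *[of h]
    by (auto simp: algebra_simps)
qed

end

text \<open>
  From here on products \<open>emb f * g\<close> and \<open>f * yy\<close> are treated as products in \<open>B\<close> and should keep this shape.
\<close>

declare mult_pCons_left [simp del] mult_pCons_right [simp del]

context surface
begin

abbreviation xx :: "'k fls poly" where "xx \<equiv> emb [:0, 1:]"

section \<open>Derivations of the coordinate ring and the Poisson bracket\<close>

definition B_derivation :: "('k fls poly \<Rightarrow> 'k fls poly) \<Rightarrow> bool" where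
  "B_derivation d \<longleftrightarrow> (\<forall>f\<in>B. \<forall>g\<in>B. d (f + g) = d f + d g \<and> d (f * g) = d f * g + f * d g)
     \<and> (\<forall>a. d (K a) = 0)"

lemma B_derivationD:
  assumes "B_derivation d"
  shows "f \<in> B \<Longrightarrow> g \<in> B \<Longrightarrow> d (f + g) = d f + d g"
    and "f \<in> B \<Longrightarrow> g \<in> B \<Longrightarrow> d (f * g) = d f * g + f * d g"
    and "d (K a) = 0"
  using assms by (auto simp: B_derivation_def)

lemma B_derivation_0: "B_derivation d \<Longrightarrow> d 0 = 0"
  using B_derivationD(3)[of d 0] by simp

lemma B_derivation_minus: "B_derivation d \<Longrightarrow> f \<in> B \<Longrightarrow> d (- f) = - d f"
  using B_derivationD(1)[of d f "- f"] B_derivation_0[of d] B_minus[of f]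
  by (simp add: eq_neg_iff_add_eq_0 add.commute)

lemma B_derivation_diff: "B_derivation d \<Longrightarrow> f \<in> B \<Longrightarrow> g \<in> B \<Longrightarrow> d (f - g) = d f - d g"
  using B_derivationD(1)[of d f "- g"] B_derivation_minus[of d g] B_minus[of g] by simp

lemma B_derivation_agree:
  assumes "B_derivation d" "B_derivation d'" "f \<in> B"
    and "d xx = d' xx" "d yy = d' yy" "d zz = d' zz"
  shows "d f = d' f"
  using assms(3) by (induction rule: B_induct)
    (use assms in \<open>simp_all only: B_derivationD[OF assms(1)] B_derivationD[OF assms(2)]\<close>)

lemma B_derivation_closed:
  assumes "B_derivation d" "f \<in> B" and "d xx \<in> B" "d yy \<in> B" "d zz \<in> B"
  shows "d f \<in> B"
  using assms(2) by (induction rule: B_induct)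
    (use assms in \<open>auto simp only: B_derivationD[OF assms(1)] intro!: B_add B_mult B_0\<close>)

lemma B_derivation_emb:
  assumes "B_derivation d"
  shows "d (emb f) = emb (pderiv f) * d xx"
proof (induction f)
  case 0
  then show ?case using B_derivation_0[OF assms] by simp
next
  case (pCons a f)
  have "emb (pCons a f) = K a + xx * emb f" by (simp add: iota_pCons mult_pCons_left)
  then have "d (emb (pCons a f)) = d xx * emb f + xx * (emb (pderiv f) * d xx)"
    using pCons by (simp only: B_derivationD[OF assms] B_K B_emb B_mult add_0_left)
  also have "\<dots> = (emb f + xx * emb (pderiv f)) * d xx" by (simp only: algebra_simps)
  also have "emb f + xx * emb (pderiv f) = emb (pderiv (pCons a f))"
    by (simp add: pderiv_pCons iota_pCons mult_pCons_left)
  finally show ?case .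
qed

text \<open>
  The partial derivatives of \<open>c z - \<lambda> y\<^sup>2 - p\<close> with respect to \<open>x\<close>, \<open>y\<close>, \<open>z\<close> are \<open>rr\<close>, \<open>- 2 \<lambda> y\<close> and \<open>c\<close>.
\<close>

definition rr :: "'k fls poly" where
  "rr = emb (pderiv c) * zz - emb (pderiv p)"

lemma B_rr [simp, intro]: "rr \<in> B" unfolding rr_def by (intro B_diff B_mult B_emb B_zz)

lemma B_derivation_surface:
  assumes d: "B_derivation d"
  shows "rr * d xx + emb c * d zz = K (2 * l) * yy * d yy"
proof -
  have "d (emb c * zz) = d (K l * yy\<^sup>2 + emb p)" by (simp only: surface_eq)
  then have "emb (pderiv c) * d xx * zz + emb c * d zz
      = (K l + K l) * yy * d yy + emb (pderiv p) * d xx"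
    unfolding power2_eq_square
    by (simp only: B_derivationD[OF d] B_K B_emb B_mult B_yy B_zz B_derivation_emb[OF d, of c]
      B_derivation_emb[OF d, of p]) (simp only: algebra_simps mult_zero_left add_0_left mult_zero_right)
  moreover have "K l + K l = K (2 * l)" by (simp add: fls_plus_const)
  ultimately show ?thesis by (simp only: rr_def) (simp only: algebra_simps)
qed

definition br :: "'k fls poly \<Rightarrow> 'k fls poly \<Rightarrow> 'k fls poly" where
  "br f g = emb c * jac f g"

lemmas DX = derivation_map_poly[OF derivation_dx]
lemmas DY = derivation_pderiv[where ?'a = "'k fls"]

lemma br_antisym: "br g f = - br f g"
  unfolding br_def jac_def by (simp only: algebra_simps minus_diff_eq mult_minus_right)

lemma br_B_derivation: "B_derivation (br f)"
  by (simp only: B_derivation_def br_def jac_def derivation_add[OF DX] derivation_mult[OF DX]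
    derivation_add[OF DY] derivation_mult[OF DY])
   (simp add: algebra_simps map_poly_pCons)

lemma br_B_derivation_left: "B_derivation (\<lambda>f. br f g)"
  using br_B_derivation[of g] unfolding B_derivation_def br_antisym[of _ g]
  by (simp add: algebra_simps)

lemma br_self: "br f f = 0"
  by (simp add: br_def jac_def mult.commute)

lemma br_xx: "br xx f = emb c * pderiv f"
  by (simp add: br_def jac_def map_poly_pCons iota_pCons one_pCons[symmetric])

lemma br_xx_yy: "br xx yy = emb c"
  by (simp add: br_xx pderiv_pCons)

lemma br_xx_zz: "br xx zz = K (2 * l) * yy"
proof -
  have "emb c * br xx zz = emb c * (K (2 * l) * yy)"
    using B_derivation_surface[OF br_B_derivation, of xx]
    by (simp only: br_self br_xx_yy mult_zero_right add_0_left) (simp only: ac_simps)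
  moreover have "emb c \<noteq> 0" by simp
  ultimately show ?thesis by (metis mult_left_cancel)
qed

lemma br_yy_zz: "br yy zz = rr"
proof -
  have "rr * br yy xx + emb c * br yy zz = 0"
    using B_derivation_surface[OF br_B_derivation, of yy] by (simp only: br_self mult_zero_right)
  then have "emb c * br yy zz = emb c * rr"
    by (simp only: br_antisym[of yy xx] br_xx_yy mult_minus_right) (simp only: eq_neg_iff_add_eq_0 neg_eq_iff_add_eq_0 add_eq_0_iff ac_simps minus_minus)
  moreover have "emb c \<noteq> 0" by simp
  ultimately show ?thesis by (metis mult_left_cancel)
qed

text \<open>
  A biderivation takes values in \<open>B\<close> as soon as it does so on pairs of generators, and there the
  values are the partial derivatives of the surface equation.
\<close>

lemma B_br:
  assumes "f \<in> B" "g \<in> B" shows "br f g \<in> B"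
proof (rule B_derivation_closed[OF br_B_derivation assms(2)])
  have *: "br xx xx \<in> B" "br xx yy \<in> B" "br xx zz \<in> B" "br yy yy \<in> B" "br yy zz \<in> B" "br zz zz \<in> B"
    by (auto simp only: br_self br_xx_yy br_xx_zz br_yy_zz intro!: B_mult)
  then have **: "br yy xx \<in> B" "br zz xx \<in> B" "br zz yy \<in> B"
    using br_antisym[of xx yy] br_antisym[of xx zz] br_antisym[of yy zz]
    by (metis B_minus minus_minus)+
  show "br f xx \<in> B" "br f yy \<in> B" "br f zz \<in> B"
    by (rule B_derivation_closed[OF br_B_derivation_left assms(1)]; fact * **)+
qed

section \<open>A simple derivation forces the surface to be smooth\<close>

definition B_ideal :: "'k fls poly set \<Rightarrow> bool" where
  "B_ideal I \<longleftrightarrow> I \<subseteq> B \<and> 0 \<in> I \<and> (\<forall>f\<in>I. \<forall>g\<in>I. f + g \<in> I) \<and> (\<forall>f\<in>B. \<forall>g\<in>I. f * g \<in> I)"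

definition B_simple :: "('k fls poly \<Rightarrow> 'k fls poly) \<Rightarrow> bool" where
  "B_simple d \<longleftrightarrow> (\<forall>I. B_ideal I \<and> d ` I \<subseteq> I \<longrightarrow> I = {0} \<or> I = B)"

text \<open>
  The ideal \<open>J\<close> of the partial derivatives of the equation \<open>F\<close> is stable under derivations: a derivation
  of \<open>B\<close> satisfies \<open>F\<^sub>x d x + F\<^sub>y d y + F\<^sub>z d z = 0\<close>, and differentiating this identity, lifted to
  polynomials, with respect to one of the variables expresses \<open>d\<close> of the corresponding partial derivative of \<open>F\<close>
  through elements of \<open>J\<close>. The normal form serves as the lift. Its odd part gives
  \<open>d y\<close> directly, and differentiating its even part by \<open>z\<close> and by \<open>x\<close> gives \<open>d c\<close> and \<open>d rr\<close>.
\<close>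

lemma jacobian_unit_ideal:
  assumes d: "B_derivation d" and dB: "\<And>f. f \<in> B \<Longrightarrow> d f \<in> B" and simple: "B_simple d"
  obtains \<alpha> \<beta> \<gamma> where "\<alpha> \<in> B" "\<beta> \<in> B" "\<gamma> \<in> B" "1 = \<alpha> * emb c + \<beta> * yy + \<gamma> * rr"
proof -
  define J where "J = {\<alpha> * emb c + \<beta> * yy + \<gamma> * rr | \<alpha> \<beta> \<gamma>. \<alpha> \<in> B \<and> \<beta> \<in> B \<and> \<gamma> \<in> B}"
  have JI: "\<alpha> * emb c + \<beta> * yy + \<gamma> * rr \<in> J" if "\<alpha> \<in> B" "\<beta> \<in> B" "\<gamma> \<in> B" for \<alpha> \<beta> \<gamma>
    using that unfolding J_def by blast
  have J_add: "f + g \<in> J" if fg: "f \<in> J" "g \<in> J" for f g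
  proof -
    obtain a b e a' b' e' where *: "a \<in> B" "b \<in> B" "e \<in> B" "a' \<in> B" "b' \<in> B" "e' \<in> B"
      "f = a * emb c + b * yy + e * rr" "g = a' * emb c + b' * yy + e' * rr"
      using fg unfolding J_def by blast
    have "f + g = (a + a') * emb c + (b + b') * yy + (e + e') * rr"
      by (simp only: *) (simp only: algebra_simps)
    then show ?thesis using * by (simp only:) (intro JI B_add)
  qed
  have J_mult: "f * g \<in> J" if fg: "f \<in> B" "g \<in> J" for f g
  proof -
    obtain a b e where *: "a \<in> B" "b \<in> B" "e \<in> B" "g = a * emb c + b * yy + e * rr"
      using fg unfolding J_def by blast
    have "f * g = (f * a) * emb c + (f * b) * yy + (f * e) * rr"
      by (simp only: *) (simp only: algebra_simps)
    then show ?thesis using * fg by (simp only:) (intro JI B_mult)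
  qed
  have gens: "emb c \<in> J" "yy \<in> J" "rr \<in> J" "0 \<in> J"
    using JI[of 1 0 0] JI[of 0 1 0] JI[of 0 0 1] JI[of 0 0 0] by auto
  have J_minus: "- f \<in> J" if "f \<in> J" for f using J_mult[OF B_minus[OF B_1] that] by simp
  have J_B: "J \<subseteq> B" unfolding J_def by (auto intro!: B_add B_mult)

  define R Q where "R = [: - pderiv p, pderiv c :]" and "Q = [: - p, c :]"
  have ev_R: "ev R = rr" by (simp add: R_def rr_def ev_pCons algebra_simps)
  have ev_Q: "ev Q = K l * yy\<^sup>2"
    using surface_eq by (simp add: Q_def ev_pCons algebra_simps)
  have ev_Q_J: "ev Q \<in> J"
    unfolding ev_Q power2_eq_square mult.assoc[symmetric] by (intro J_mult B_mult gens B_K B_yy)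
  obtain a0 a1 where a: "d xx = ev a0 + ev a1 * yy" using dB[OF B_emb] unfolding B_def by blast
  obtain b0 b1 where b: "d yy = ev b0 + ev b1 * yy" using dB[OF B_yy] unfolding B_def by blast
  obtain e0 e1 where e: "d zz = ev e0 + ev e1 * yy" using dB[OF B_zz] unfolding B_def by blast
  \<comment> \<open>the defining equation, differentiated and separated into its even and odd part in \<open>y\<close>\<close>
  define S0 S1 where "S0 = a0 * R + [:c:] * e0 - b1 * Q - b1 * Q"
    and "S1 = a1 * R + [:c:] * e1 - [:[:2 * l:]:] * b0"
  have K2: "K (2 * l) = K l + K l" by (simp add: fls_plus_const)
  have K2': "emb [:2 * l:] = K l + K l" by (simp add: iota_pCons fls_plus_const)
  have "ev S0 + ev S1 * yy = 0"
  proof -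
    have "ev S0 + ev S1 * yy = rr * d xx + emb c * d zz - (K l + K l) * yy * d yy"
      unfolding S0_def S1_def a b e
      by (simp only: ev_diff ev_add ev_mult ev_const ev_R ev_Q K2')
        (simp only: algebra_simps power2_eq_square)
    then show ?thesis by (simp only: B_derivation_surface[OF d] K2 diff_self)
  qed
  then have S: "S0 = 0" "S1 = 0" using normal_form_unique by blast+
  have R': "pderiv R = [:pderiv c:]" "pderiv Q = [:c:]"
    by (simp_all add: R_def Q_def pderiv_pCons)
  have "a0 * [:pderiv c:] + (pderiv a0 * R + [:c:] * pderiv e0 - pderiv b1 * Q - pderiv b1 * Q
      - [:c:] * b1 - [:c:] * b1) = pderiv S0"
    unfolding S0_def by (simp add: pderiv_add pderiv_diff pderiv_mult R' pderiv_pCons algebra_simps)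
  then have c_eq: "ev a0 * emb (pderiv c) = - (ev (pderiv a0) * rr + emb c * ev (pderiv e0)
      - ev (pderiv b1) * ev Q - ev (pderiv b1) * ev Q - emb c * ev b1 - emb c * ev b1)"
    unfolding S(1) pderiv_0 ev_R[symmetric] ev_const[symmetric] ev_mult[symmetric] ev_add[symmetric]
      ev_diff[symmetric] ev_minus[symmetric]
    by (intro arg_cong[where f = ev]) (simp only: eq_neg_iff_add_eq_0)
  \<comment> \<open>\<open>pderiv\<close> on \<open>k[x][z]\<close> was \<open>\<partial>/\<partial>z\<close>; \<open>dd\<close> is \<open>\<partial>/\<partial>x\<close>\<close>
  define dd where "dd = map_poly (pderiv :: 'k poly \<Rightarrow> _)"
  have dd: "derivation dd" unfolding dd_def by (rule derivation_map_poly[OF derivation_pderiv])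
  have dd_diff: "dd (u - v) = dd u - dd v" for u v
    using derivation_add[OF dd, of "u - v" v] by simp
  have R'': "dd R = [: - pderiv (pderiv p), pderiv (pderiv c) :]" "dd Q = R" "dd [:c:] = [:pderiv c:]"
    by (simp_all add: R_def Q_def dd_def map_poly_pCons pderiv_minus)
  have "a0 * dd R + [:pderiv c:] * e0 + (dd a0 * R + [:c:] * dd e0 - dd b1 * Q - dd b1 * Q
      - b1 * R - b1 * R) = dd S0"
    unfolding S0_def by (simp only: derivation_add[OF dd] dd_diff derivation_mult[OF dd] R''(2,3))
      (simp only: algebra_simps)
  then have r_eq: "ev a0 * ev (dd R) + emb (pderiv c) * ev e0 = - (ev (dd a0) * rr + emb c * ev (dd e0)
      - ev (dd b1) * ev Q - ev (dd b1) * ev Q - ev b1 * rr - ev b1 * rr)"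
    unfolding S(1) derivation_0[OF dd] ev_R[symmetric] ev_const[symmetric] ev_mult[symmetric]
      ev_add[symmetric] ev_diff[symmetric] ev_minus[symmetric]
    by (intro arg_cong[where f = ev]) (simp only: eq_neg_iff_add_eq_0)
  have J_diff: "f - g \<in> J" if "f \<in> J" "g \<in> J" for f g
    using J_add[OF that(1) J_minus[OF that(2)]] by simp
  have J_mult': "g * f \<in> J" if "f \<in> B" "g \<in> J" for f g
    using J_mult[OF that] by (simp only: mult.commute)
  note J_intros = J_minus J_diff J_add J_mult[OF B_ev] J_mult'[OF B_ev] J_mult[OF B_emb] gens ev_Q_J
  have d_c: "d (emb c) \<in> J"
  proof -
    have "d (emb c) = ev a0 * emb (pderiv c) + (emb (pderiv c) * ev a1) * yy"
      by (simp only: B_derivation_emb[OF d, of c] a) (simp only: algebra_simps)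
    moreover have "ev a0 * emb (pderiv c) \<in> J" unfolding c_eq by (intro J_intros)
    moreover have "(emb (pderiv c) * ev a1) * yy \<in> J" by (intro J_mult B_mult B_emb B_ev gens)
    ultimately show ?thesis by (simp only: J_add)
  qed
  have d_y: "d yy \<in> J"
  proof -
    have "(K l + K l) * ev b0 = ev a1 * rr + emb c * ev e1 - ev S1"
      unfolding S1_def by (simp only: ev_diff ev_add ev_mult ev_const ev_R K2') (simp only: algebra_simps)
    then have "K (2 * l) * ev b0 = ev a1 * rr + emb c * ev e1" by (simp only: K2 S ev_0 diff_0_right)
    moreover have "ev a1 * rr + emb c * ev e1 \<in> J" by (intro J_intros)
    ultimately have "K (1 / (2 * l)) * (K (2 * l) * ev b0) \<in> J" using J_mult[OF B_K] by (simp only:)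
    moreover have "K (1 / (2 * l)) * (K (2 * l) * ev b0) = ev b0"
      using l by (simp add: mult_pCons_left fls_const_mult_const flip: mult.assoc one_pCons)
    ultimately show ?thesis unfolding b by (intro J_add J_mult B_ev gens) (simp only:)
  qed
  have d_r: "d rr \<in> J"
  proof -
    have "d rr = d (emb (pderiv c)) * zz + emb (pderiv c) * d zz - d (emb (pderiv p))"
      unfolding rr_def by (simp only: B_derivation_diff[OF d] B_derivationD[OF d] B_emb B_zz B_mult)
    also have "\<dots> = d xx * (emb (pderiv (pderiv c)) * zz - emb (pderiv (pderiv p))) + emb (pderiv c) * d zz"
      by (simp only: B_derivation_emb[OF d, of "pderiv _"]) (simp only: algebra_simps)
    also have "emb (pderiv (pderiv c)) * zz - emb (pderiv (pderiv p)) = ev (dd R)"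
      by (simp add: R'' ev_pCons algebra_simps)
    finally have "d rr = (ev a0 * ev (dd R) + emb (pderiv c) * ev e0)
        + (ev a1 * ev (dd R) + emb (pderiv c) * ev e1) * yy"
      by (simp only: a e) (simp only: algebra_simps)
    moreover have "ev a0 * ev (dd R) + emb (pderiv c) * ev e0 \<in> J" unfolding r_eq by (intro J_intros)
    moreover have "(ev a1 * ev (dd R) + emb (pderiv c) * ev e1) * yy \<in> J"
      by (intro J_mult B_add B_mult B_emb B_ev gens)
    ultimately show ?thesis by (simp only: J_add)
  qed
  have "d f \<in> J" if f: "f \<in> J" for f
  proof -
    obtain \<alpha> \<beta> \<gamma> where *: "\<alpha> \<in> B" "\<beta> \<in> B" "\<gamma> \<in> B" "f = \<alpha> * emb c + \<beta> * yy + \<gamma> * rr"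
      using f unfolding J_def by blast
    have "d f = (d \<alpha> * emb c + \<alpha> * d (emb c)) + (d \<beta> * yy + \<beta> * d yy) + (d \<gamma> * rr + \<gamma> * d rr)"
      unfolding * by (simp only: B_derivationD[OF d] * B_emb B_yy B_rr B_mult B_add)
    also have "\<dots> \<in> J" by (intro J_add J_mult dB * gens d_c d_y d_r)
    finally show ?thesis .
  qed
  moreover have "B_ideal J" unfolding B_ideal_def using J_B gens J_add J_mult by blast
  ultimately have "J = {0} \<or> J = B" using simple unfolding B_simple_def by blast
  moreover have "J \<noteq> {0}" using gens(2) by auto
  ultimately have "1 \<in> J" by simp
  then show ?thesis using that unfolding J_def by blast
qed

section \<open>Automorphisms scale the bracket\<close>

definition B_endo :: "('k fls poly \<Rightarrow> 'k fls poly) \<Rightarrow> bool" where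
  "B_endo s \<longleftrightarrow> (\<forall>f\<in>B. s f \<in> B) \<and> (\<forall>f\<in>B. \<forall>g\<in>B. s (f + g) = s f + s g \<and> s (f * g) = s f * s g)
     \<and> (\<forall>a. s (K a) = K a)"

lemma B_endoD:
  assumes "B_endo s"
  shows "f \<in> B \<Longrightarrow> s f \<in> B"
    and "f \<in> B \<Longrightarrow> g \<in> B \<Longrightarrow> s (f + g) = s f + s g"
    and "f \<in> B \<Longrightarrow> g \<in> B \<Longrightarrow> s (f * g) = s f * s g"
    and "s (K a) = K a"
  using assms by (auto simp: B_endo_def)

text \<open>
  A unit has degree 0 in \<open>y\<close>, and elements of \<open>B\<close> of degree 0 in \<open>y\<close> are polynomials in \<open>x\<close>.
\<close>

lemma B_unit:
  assumes "f \<in> B" "g \<in> B" "f * g = 1"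
  obtains k where "k \<noteq> 0" "f = K k"
proof -
  have nz: "f \<noteq> 0" "g \<noteq> 0" using assms(3) by auto
  have "deg f + deg g = 0" using degree_mult_eq[OF nz] assms(3) by simp
  then obtain a b where ab: "f = emb a" "g = emb b" using B_deg_0 assms by (metis add_is_0)
  with assms(3) have "[:iota (a * b):] = [:iota 1:]" by (simp add: mult_pCons_left flip: one_pCons)
  then have "a * b = 1" by (simp only: iota_inj pCons_eq_iff)
  then have "a dvd 1" by (metis dvd_triv_left)
  then obtain k where "a = [:k:]" by (auto simp: is_unit_poly_iff)
  moreover from this \<open>a * b = 1\<close> have "k \<noteq> 0" by auto
  ultimately show ?thesis using ab by (intro that[of k]) (simp_all add: K_emb)
qed

text \<open>
  The transported bracket \<open>W\<close> is an alternating biderivation. Applied to the surface equation, it gives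
  linear relations by which its values on pairs of generators are proportional to the partial derivatives of the equation,
  that is, to the values of \<open>br\<close>. As these generate the unit ideal, the factor of
  proportionality \<open>\<kappa>\<close> is an element of \<open>B\<close>; applying \<open>s\<close> to the expression of 1 by
  brackets shows that \<open>\<kappa>\<close> divides 1.
\<close>

lemma automorphism_scales_bracket:
  assumes s: "B_endo s" and t: "B_endo t"
    and st: "\<And>f. f \<in> B \<Longrightarrow> s (t f) = f" and ts: "\<And>f. f \<in> B \<Longrightarrow> t (s f) = f"
    and unit: "\<alpha> \<in> B" "\<beta> \<in> B" "\<gamma> \<in> B" "1 = \<alpha> * emb c + \<beta> * yy + \<gamma> * rr"
  obtains k where "k \<noteq> 0" "\<And>f g. f \<in> B \<Longrightarrow> g \<in> B \<Longrightarrow> s (br (t f) (t g)) = K k * br f g"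
proof -
  define W where "W = (\<lambda>f g. s (br (t f) (t g)))"
  note sD = B_endoD[OF s] and tD = B_endoD[OF t]
  have W_der: "B_derivation (W f)" if "f \<in> B" for f
    unfolding B_derivation_def W_def
    by (simp add: that sD tD st B_br B_mult B_derivationD[OF br_B_derivation] B_derivationD[OF br_B_derivation, of 0]
      ) (metis fls_const_0 pCons_0_0 sD(4))
  have s_minus: "s (- f) = - s f" if "f \<in> B" for f
    using that sD(2)[of f "- f"] sD(4)[of 0] by (simp add: B_minus eq_neg_iff_add_eq_0 add.commute)
  have W_anti: "W g f = - W f g" if "f \<in> B" "g \<in> B" for f g
    unfolding W_def br_antisym[of "t g" "t f"] using that by (simp add: s_minus B_br tD)
  have W_self: "W f f = 0" for f using sD(4)[of 0] by (simp add: W_def br_self)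
  have W_der_left: "B_derivation (\<lambda>f. W f g)" if "g \<in> B" for g
    using W_der[OF that] that W_anti[OF that] unfolding B_derivation_def
    by (simp add: B_add B_mult)
  have W_B: "W f g \<in> B" if "f \<in> B" "g \<in> B" for f g using that by (auto simp: W_def intro!: sD tD B_br)
  define a b e where "a = W xx yy" and "b = W xx zz" and "e = W yy zz"
  have r1: "emb c * b = K (2 * l) * yy * a"
    using B_derivation_surface[OF W_der, of xx] by (simp add: W_self a_def b_def)
  have r2: "emb c * e = rr * a"
    using B_derivation_surface[OF W_der, of yy] W_anti[of xx yy]
    by (simp add: W_self a_def e_def)
  have r3: "rr * b = K (2 * l) * yy * e"
    using B_derivation_surface[OF W_der, of zz] W_anti[of xx zz] W_anti[of yy zz]
    by (simp add: W_self b_def e_def)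
  have half: "K (1 / (2 * l)) * K (2 * l) = 1"
    using l by (simp add: mult_pCons_left fls_const_mult_const flip: one_pCons)
  \<comment> \<open>\<open>1 = \<alpha> c + \<beta> y + \<gamma> rr\<close> with the partial derivatives replaced by the corresponding values of \<open>W\<close>\<close>
  define \<kappa> where "\<kappa> = \<alpha> * a + \<beta> * K (1 / (2 * l)) * b + \<gamma> * e"
  have k1: "W xx yy = \<kappa> * br xx yy"
  proof -
    have "\<kappa> * emb c = \<alpha> * emb c * a + \<beta> * K (1 / (2 * l)) * (emb c * b) + \<gamma> * (emb c * e)"
      by (simp only: \<kappa>_def) (simp only: algebra_simps)
    also have "\<dots> = \<alpha> * emb c * a + (K (1 / (2 * l)) * K (2 * l)) * \<beta> * yy * a + \<gamma> * rr * a"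
      by (simp only: r1 r2) (simp only: algebra_simps)
    also have "\<dots> = (\<alpha> * emb c + \<beta> * yy + \<gamma> * rr) * a" by (simp only: half) (simp only: algebra_simps mult_1_left)
    finally show ?thesis by (simp only: unit(4)[symmetric] br_xx_yy a_def mult_1_left)
  qed
  have k2: "W xx zz = \<kappa> * br xx zz"
  proof -
    have "\<kappa> * (K (2 * l) * yy) = \<alpha> * (K (2 * l) * yy * a) + (K (1 / (2 * l)) * K (2 * l)) * \<beta> * yy * b + \<gamma> * (K (2 * l) * yy * e)"
      by (simp only: \<kappa>_def) (simp only: algebra_simps)
    also have "\<dots> = (\<alpha> * emb c + \<beta> * yy + \<gamma> * rr) * b" 
      by (simp only: half flip: r1 r3) (simp only: algebra_simps mult_1_left)
    finally show ?thesis by (simp only: unit(4)[symmetric] br_xx_zz b_def mult_1_left)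
  qed
  have k3: "W yy zz = \<kappa> * br yy zz"
  proof -
    have "\<kappa> * rr = \<alpha> * (rr * a) + \<beta> * K (1 / (2 * l)) * (rr * b) + \<gamma> * rr * e"
      by (simp only: \<kappa>_def) (simp only: algebra_simps)
    also have "\<dots> = \<alpha> * emb c * e + (K (1 / (2 * l)) * K (2 * l)) * \<beta> * yy * e + \<gamma> * rr * e"
      by (simp only: r3 flip: r2) (simp only: algebra_simps)
    also have "\<dots> = (\<alpha> * emb c + \<beta> * yy + \<gamma> * rr) * e" by (simp only: half) (simp only: algebra_simps mult_1_left)
    finally show ?thesis by (simp only: unit(4)[symmetric] br_yy_zz e_def mult_1_left)
  qed
  have \<kappa>_B: "\<kappa> \<in> B" unfolding \<kappa>_def a_def b_def e_def by (intro B_add B_mult unit B_K W_B B_emb B_yy B_zz)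
  have scaled: "B_derivation (\<lambda>g. \<kappa> * br f g)" "B_derivation (\<lambda>g. \<kappa> * br g f)" for f
    using br_B_derivation[of f] br_B_derivation_left[of f] unfolding B_derivation_def by (auto simp: algebra_simps)
  have W_gen: "W f g = \<kappa> * br f g" if "f \<in> {xx, yy, zz}" "g \<in> B" for f g
  proof (rule B_derivation_agree[OF W_der scaled(1) that(2)])
    show "f \<in> B" using that by auto
    have m: "W v u = \<kappa> * br v u" if "W u v = \<kappa> * br u v" "u \<in> B" "v \<in> B" for u v
      using that W_anti[of u v] br_antisym[of v u] by simp
    show "W f xx = \<kappa> * br f xx" "W f yy = \<kappa> * br f yy" "W f zz = \<kappa> * br f zz"
      using that(1) k1 k2 k3 m[OF k1] m[OF k2] m[OF k3] by (auto simp only: W_self br_self mult_zero_right B_emb B_yy B_zz)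
  qed
  have W_br: "W f g = \<kappa> * br f g" if "f \<in> B" "g \<in> B" for f g
    by (rule B_derivation_agree[OF W_der_left[OF that(2)] scaled(2) that(1)]) (rule W_gen; use that in simp)+
  have s_br: "s (br f g) = \<kappa> * br (s f) (s g)" if "f \<in> B" "g \<in> B" for f g
    using W_br[of "s f" "s g"] that by (simp add: W_def ts sD)
  define \<kappa>' where "\<kappa>' = s \<alpha> * br (s xx) (s yy) + s \<beta> * K (1 / (2 * l)) * br (s xx) (s zz) + s \<gamma> * br (s yy) (s zz)"
  have "\<kappa>' \<in> B" unfolding \<kappa>'_def by (intro B_add B_mult B_br sD unit B_K B_emb B_yy B_zz)
  moreover have "\<kappa> * \<kappa>' = 1"
  proof -
    have "1 = \<alpha> * br xx yy + \<beta> * K (1 / (2 * l)) * br xx zz + \<gamma> * br yy zz"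
    proof -
      have "\<alpha> * br xx yy + \<beta> * K (1 / (2 * l)) * br xx zz + \<gamma> * br yy zz
        = \<alpha> * emb c + (K (1 / (2 * l)) * K (2 * l)) * \<beta> * yy + \<gamma> * rr"
        by (simp only: br_xx_yy br_xx_zz br_yy_zz) (simp only: algebra_simps)
      then show ?thesis by (simp only: half mult_1_left unit(4)[symmetric])
    qed
    then have "s 1 = s (\<alpha> * br xx yy + \<beta> * K (1 / (2 * l)) * br xx zz + \<gamma> * br yy zz)" by (rule arg_cong)
    also have "\<dots> = s \<alpha> * s (br xx yy) + s \<beta> * K (1 / (2 * l)) * s (br xx zz) + s \<gamma> * s (br yy zz)"
      by (simp only: sD unit B_K B_emb B_yy B_zz B_br B_mult B_add)
    also have "\<dots> = \<kappa> * \<kappa>'"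
      by (simp only: s_br B_emb B_yy B_zz \<kappa>'_def) (simp only: algebra_simps)
    finally show ?thesis using sD(4)[of 1] by (simp add: one_pCons)
  qed
  ultimately obtain k where "k \<noteq> 0" "\<kappa> = K k" using B_unit \<kappa>_B by blast
  then show ?thesis using W_br by (intro that[of k]) (simp_all add: W_def)
qed

end

context surface
begin

section \<open>Automorphisms preserve k[x]\<close>

lemma br_xx_nilpotent: "deg g < N \<Longrightarrow> (br xx ^^ N) g = 0"
proof (induction N arbitrary: g)
  case (Suc N)
  have zero: "(br xx ^^ m) 0 = 0" for m by (induction m) (simp_all add: br_xx)
  show ?case
  proof (cases "deg g")
    case 0
    then have "pderiv g = 0" by (simp add: pderiv_eq_0_iff)
    then have "br xx g = 0" by (simp add: br_xx)
    then show ?thesis by (simp add: funpow_Suc_right zero del: funpow.simps)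
  next
    case (Suc d)
    then have "deg (br xx g) < N"
      using Suc.prems degree_mult_le[of "emb c" "pderiv g"] degree_pderiv[of g] by (simp add: br_xx)
    then show ?thesis using Suc.IH by (simp add: funpow_Suc_right del: funpow.simps)
  qed
qed simp

text \<open>\<open>jac_lead\<close> for the bracket: the factor \<open>c\<close> adds its degree to the exponent of \<open>x\<close>.\<close>

lemma br_lead:
  assumes "f \<noteq> 0" "g \<noteq> 0"
    and ne: "xdeg (lead f) * int (deg g) - int (deg f) * xdeg (lead g) \<noteq> 0"
  shows "br f g \<noteq> 0"
    and "int (deg (br f g)) = int (deg f) + int (deg g) - 1"
    and "xdeg (lead (br f g)) = xdeg (lead f) + xdeg (lead g) + int (deg c) - 1"
proof -
  have c: "iota c \<noteq> 0" by simp
  have br: "br f g = smult (iota c) (jac f g)" by (simp add: br_def mult_pCons_left)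
  note j = jac_lead[OF assms]
  show "br f g \<noteq> 0" "int (deg (br f g)) = int (deg f) + int (deg g) - 1"
    using j by (simp_all add: br)
  show "xdeg (lead (br f g)) = xdeg (lead f) + xdeg (lead g) + int (deg c) - 1"
    using j by (simp add: br subdegree_iota)
qed

text \<open>
  Let \<open>u\<close> have the leading term \<open>x\<^sup>i y\<^sup>j\<close> and \<open>c\<close> the degree \<open>n\<close>. Each application of \<open>{u, _}\<close> shifts the exponents by \<open>(i + n - 1, j - 1)\<close>,
  so after \<open>m\<close> steps from \<open>x\<close> they are \<open>(1 + m (i + n - 1), m (j - 1))\<close>. Their determinant with \<open>(i, j)\<close> is
  \<open>- j - m (i + j (n - 1))\<close>, which is negative: \<open>B_weight\<close> gives \<open>i \<ge> - n j / 2\<close>, and \<open>n / 2 \<le> n - 1\<close>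
  as \<open>n \<ge> 2\<close>. Therefore the leading term never cancels.
\<close>

lemma bracket_orbit_nonzero:
  assumes u: "u \<in> B" "deg u > 0" and k: "k \<noteq> 0"
  shows "((\<lambda>f. K k * br u f) ^^ m) xx \<noteq> 0"
proof -
  define F where "F = (\<lambda>f. K k * br u f)"
  define i j n where "i = xdeg (lead u)" and "j = int (deg u)" and "n = int (deg c)"
  have u0: "u \<noteq> 0" using u(2) by auto
  have "2 * i + n * j \<ge> 0" using B_weight[OF u(1) u0] by (simp add: i_def j_def n_def)
  moreover have "(n - 2) * j \<ge> 0" using deg_c by (simp add: n_def j_def)
  ultimately have w: "i + j * (n - 1) \<ge> 0" by (simp add: algebra_simps)
  have "(F ^^ m) xx \<noteq> 0 \<and> int (deg ((F ^^ m) xx)) = int m * (j - 1)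
    \<and> xdeg (lead ((F ^^ m) xx)) = 1 + int m * (i + n - 1)"
  proof (induction m)
    case 0
    then show ?case by (simp add: subdegree_iota)
  next
    case (Suc m)
    define f where "f = (F ^^ m) xx"
    note IH = Suc[folded f_def]
    have "i * (int m * (j - 1)) - j * (1 + int m * (i + n - 1)) = - (j + int m * (i + j * (n - 1)))"
      by (simp add: algebra_simps)
    also have "j + int m * (i + j * (n - 1)) > 0"
      using w u(2) by (intro add_pos_nonneg mult_nonneg_nonneg) (simp_all add: j_def)
    then have "- (j + int m * (i + j * (n - 1))) \<noteq> 0" by linarith
    finally have ne: "xdeg (lead u) * int (deg f) - int (deg u) * xdeg (lead f) \<noteq> 0"
      using IH by (simp only: i_def j_def simp_thms)
    note b = br_lead[OF u0 conjunct1[OF IH] ne]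
    have "F f = smult (fls_const k) (br u f)" by (simp add: F_def mult_pCons_left)
    then have "F f \<noteq> 0" "deg (F f) = deg (br u f)" "xdeg (lead (F f)) = xdeg (lead (br u f))"
      using b(1) k by (simp_all)
    moreover have "(F ^^ Suc m) xx = F f" by (simp add: f_def)
    ultimately show ?case using b IH by (simp add: i_def[symmetric] j_def[symmetric] n_def[symmetric] algebra_simps)
  qed
  then show ?thesis by (simp add: F_def)
qed

definition B_inverse :: "('k fls poly \<Rightarrow> 'k fls poly) \<Rightarrow> ('k fls poly \<Rightarrow> 'k fls poly) \<Rightarrow> bool" where
  "B_inverse s t \<longleftrightarrow> B_endo s \<and> B_endo t \<and> (\<forall>f\<in>B. s (t f) = f \<and> t (s f) = f)"

definition scales_bracket :: "('k fls poly \<Rightarrow> 'k fls poly) \<Rightarrow> 'k \<Rightarrow> bool" where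
  "scales_bracket s k \<longleftrightarrow> (\<forall>f\<in>B. \<forall>g\<in>B. s (br f g) = K k * br (s f) (s g))"

text \<open>
  Up to constants \<open>s\<close> conjugates \<open>{x, _}\<close> into \<open>{s x, _}\<close>, so the latter is locally nilpotent too.
\<close>

lemma image_of_x_deg_0:
  assumes st: "B_inverse s t" and k: "k \<noteq> 0" "scales_bracket s k"
  shows "deg (s xx) = 0"
proof (rule ccontr)
  assume "deg (s xx) \<noteq> 0"
  have s: "B_endo s" and t: "B_endo t" and inv: "\<And>f. f \<in> B \<Longrightarrow> s (t f) = f"
    using st by (auto simp: B_inverse_def)
  have B: "(br xx ^^ m) f \<in> B" if "f \<in> B" for m f by (induction m) (use that in \<open>auto intro: B_br\<close>)
  have orbit: "s ((br xx ^^ m) (t xx)) = ((\<lambda>f. K k * br (s xx) f) ^^ m) xx" for m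
  proof (induction m)
    case 0
    then show ?case by (simp add: inv)
  next
    case (Suc m)
    then show ?case using k(2) B B_endoD(1)[OF t B_emb] by (simp add: scales_bracket_def)
  qed
  have "s 0 = 0" using B_endoD(4)[OF s, of 0] by simp
  then have "((\<lambda>f. K k * br (s xx) f) ^^ Suc (deg (t xx))) xx = 0"
    using orbit[of "Suc (deg (t xx))"] br_xx_nilpotent[of "t xx" "Suc (deg (t xx))"]
    by (simp del: funpow.simps)
  then show False
    using bracket_orbit_nonzero[of "s xx" k] B_endoD(1)[OF s B_emb] \<open>deg (s xx) \<noteq> 0\<close> k(1) by blast
qed

lemma B_endo_emb:
  assumes "B_endo s" "s xx = emb U"
  shows "s (emb f) = emb (pcompose f U)"
proof (induction f)
  case 0
  then show ?case using B_endoD(4)[OF assms(1), of 0] by simp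
next
  case (pCons a f)
  have "emb (pCons a f) = K a + xx * emb f" by (simp add: iota_pCons mult_pCons_left)
  then have "s (emb (pCons a f)) = K a + emb U * emb (pcompose f U)"
    using pCons assms(2) by (simp only: B_endoD[OF assms(1)] B_K B_emb B_mult)
  then show ?case by (simp add: pcompose_pCons mult_pCons_left K_emb)
qed

text \<open>Both \<open>s\<close> and its inverse map \<open>x\<close> to a polynomial in \<open>x\<close>, and a polynomial with a compositional inverse is linear.\<close>

lemma image_of_x_affine:
  assumes st: "B_inverse s t"
    and k: "k \<noteq> 0" "scales_bracket s k" and k': "k' \<noteq> 0" "scales_bracket t k'"
  obtains \<alpha> \<beta> where "\<alpha> \<noteq> 0" "s xx = emb [:\<beta>, \<alpha>:]"
proof -
  have ts: "B_inverse t s" and s: "B_endo s" and t: "B_endo t" and inv: "s (t xx) = xx"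
    using st by (auto simp: B_inverse_def)
  obtain U where U: "s xx = emb U"
    using B_deg_0[OF B_endoD(1)[OF s B_emb] image_of_x_deg_0[OF st k]] by blast
  obtain V where V: "t xx = emb V"
    using B_deg_0[OF B_endoD(1)[OF t B_emb] image_of_x_deg_0[OF ts k']] by blast
  have "emb (pcompose V U) = xx" using inv V B_endo_emb[OF s U] by simp
  then have "pcompose V U = [:0, 1:]" by (simp only: pCons_eq_iff iota_inj)
  then have "deg V * deg U = 1" using degree_pcompose[of V U] by simp
  then have "deg U = 1" by simp
  then obtain \<beta> \<alpha> where "U = [:\<beta>, \<alpha>:]" "\<alpha> \<noteq> 0"
    by (metis degree_eq_zeroE degree_pCons_eq_if pCons_cases one_neq_zero pCons_0_0 Suc_inject One_nat_def pCons_eq_0_iff)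
  then show ?thesis using U by (intro that) auto
qed

end

locale rigid_surface = surface c p l
  for c p :: "'k::field_char_0 poly" and l :: 'k +
  assumes centered_c: "cf c (deg c - 1) = 0"
    and deg_p: "deg p < deg c"
    and p0: "cf p 0 \<noteq> 0" and p1: "cf p 1 \<noteq> 0"
begin

section \<open>Shape of the automorphisms\<close>

text \<open>The roots of \<open>c\<close> have sum 0, and so have their images under an affine map that permutes them.\<close>

lemma affine_symmetry_is_scaling:
  assumes "\<alpha> \<noteq> 0" "pcompose c [:\<beta>, \<alpha>:] = smult m c"
  shows "\<beta> = 0"
proof -
  obtain N where N: "deg c = Suc N" using deg_c by (cases "deg c") auto
  have "cf (pcompose c [:\<beta>, \<alpha>:]) N = \<alpha> ^ N * (cf c N + of_nat (Suc N) * \<beta> * cf c (Suc N))"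
    by (rule coeff_pcompose_subleading) (simp add: N)
  moreover have "cf c N = 0" "cf c (Suc N) \<noteq> 0" using centered_c N by auto (metis N c_nz leading_coeff_0_iff)
  ultimately show ?thesis using assms by (simp del: of_nat_Suc)
qed

lemma deg_emb_mult: "deg (emb c * f) = deg f"
  by (simp add: mult_pCons_left)

text \<open>
  Applying \<open>s\<close> to \<open>{x, y} = c\<close> shows that \<open>s y\<close> is linear in \<open>y\<close>, with a leading coefficient
  that is constant because \<open>c(s x)\<close> and \<open>c\<close> have the same degree. The remaining information is in the surface equation:
  subtracting a multiple of it from its image leaves an identity \<open>c E = \<dots>\<close> of degree at most 1 in \<open>y\<close>, hence
  with polynomial coefficients, which gives the two divisibilities by \<open>c\<close>.
\<close>

lemma automorphism_form:
  assumes s: "B_endo s" and k: "k \<noteq> 0" "scales_bracket s k"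
    and \<alpha>: "\<alpha> \<noteq> 0" "s xx = emb [:\<beta>, \<alpha>:]"
  obtains b \<epsilon> where "s xx = xx" "s yy = emb b + K \<epsilon> * yy" "c dvd b" "\<epsilon> = 1 \<or> \<epsilon> = - 1"
proof -
  define U where "U = [:\<beta>, \<alpha>:]"
  note sD = B_endoD[OF s]
  have s_emb: "s (emb f) = emb (pcompose f U)" for f
    using B_endo_emb[OF s] \<alpha>(2) by (simp only: U_def)
  have "s (br xx yy) = K k * br (emb U) (s yy)"
    using k(2) \<alpha>(2) by (simp only: scales_bracket_def B_emb B_yy U_def)
  also have "br (emb U) (s yy) = emb c * (emb (pderiv U) * pderiv (s yy))"
    by (simp add: br_def jac_def map_poly_pCons)
  also have "emb (pderiv U) = K \<alpha>" by (simp add: U_def pderiv_pCons K_emb)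
  finally have c1: "emb (pcompose c U) = emb c * (K (k * \<alpha>) * pderiv (s yy))"
    by (simp only: br_xx_yy s_emb K_mult) (simp only: ac_simps)
  then have "deg (emb (pcompose c U)) = deg (pderiv (s yy))"
    using k(1) \<alpha>(1) by (simp add: mult_pCons_left)
  then have "deg (s yy) \<le> 1" by (simp add: degree_pderiv)
  then obtain b a where ba: "s yy = emb b + emb a * yy" "s yy = [: iota b, iota a :]"
    using B_deg_le_1[OF sD(1)[OF B_yy]] by metis
  have "[:iota (pcompose c U):] = [:iota (c * smult (k * \<alpha>) a):]"
    using c1 unfolding ba(2) by (simp add: pderiv_pCons mult_pCons_left ac_simps)
  then have c2: "pcompose c U = c * smult (k * \<alpha>) a" by (simp only: pCons_eq_iff iota_inj)
  have "pcompose c U \<noteq> 0" using \<alpha>(1) pcompose_eq_0[of c U] by (auto simp: U_def)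
  then have a_nz: "a \<noteq> 0" using c2 by auto
  have "deg (pcompose c U) = deg c" using \<alpha>(1) by (simp add: degree_pcompose U_def)
  then have "deg a = 0" using a_nz k(1) \<alpha>(1) by (simp add: c2 degree_mult_eq)
  then obtain \<epsilon> where \<epsilon>: "a = [:\<epsilon>:]" by (rule degree_eq_zeroE)
  with a_nz have \<epsilon>0: "\<epsilon> \<noteq> 0" by auto
  define m where "m = k * \<alpha> * \<epsilon>"
  have c3: "pcompose c U = smult m c" using c2 by (simp add: \<epsilon> m_def mult_pCons_right)
  have \<beta>: "\<beta> = 0" using affine_symmetry_is_scaling[OF \<alpha>(1)] c3 by (simp add: U_def)
  have yy: "s yy = emb b + K \<epsilon> * yy" using ba(1) \<epsilon> by (simp add: K_emb)

  define E where "E = K m * s zz - K (\<epsilon>\<^sup>2) * zz"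
  have "s (emb c * zz) = s (K l * (yy * yy) + emb p)" by (simp only: surface_eq power2_eq_square)
  then have "emb (pcompose c U) * s zz = K l * (s yy * s yy) + emb (pcompose p U)"
    by (simp only: sD B_K B_emb B_mult B_yy B_zz s_emb)
  then have z1: "emb c * (K m * s zz) = K l * (s yy * s yy) + emb (pcompose p U)"
  proof -
    have "emb (pcompose c U) = emb c * K m" by (simp add: c3 mult_pCons_left ac_simps)
    then show ?thesis using \<open>emb (pcompose c U) * s zz = _\<close> by (simp only: mult.assoc)
  qed
  have z2: "emb c * (K (\<epsilon>\<^sup>2) * zz) = K l * ((K \<epsilon> * yy) * (K \<epsilon> * yy)) + K (\<epsilon>\<^sup>2) * emb p"
    (is "?l = ?r")
  proof -
    have "?l = K (\<epsilon>\<^sup>2) * (emb c * zz)" by (simp only: ac_simps)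
    also have "\<dots> = K l * (K (\<epsilon>\<^sup>2) * (yy * yy)) + K (\<epsilon>\<^sup>2) * emb p"
      by (simp only: surface_eq power2_eq_square[of yy]) (simp only: algebra_simps)
    also have "K (\<epsilon>\<^sup>2) * (yy * yy) = (K \<epsilon> * yy) * (K \<epsilon> * yy)"
      by (simp add: mult_pCons_left power2_eq_square fls_const_mult_const)
    finally show ?thesis .
  qed
  have "emb c * E = K l * (s yy * s yy - (K \<epsilon> * yy) * (K \<epsilon> * yy)) + (emb (pcompose p U) - K (\<epsilon>\<^sup>2) * emb p)"
    unfolding E_def right_diff_distrib z1 z2 by (simp only: algebra_simps)
  also have "\<dots> = [: iota (smult l (b * b) + (pcompose p U - smult (\<epsilon>\<^sup>2) p)), iota (smult (l * \<epsilon>) b + smult (l * \<epsilon>) b) :]"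
    unfolding yy by (simp add: mult_pCons_left mult_pCons_right) (simp add: algebra_simps fls_const_mult_const iota_numeral_2)
  finally have cE: "emb c * E = \<dots>" .
  have "E \<in> B" unfolding E_def by (intro B_diff B_mult B_K sD(1) B_zz)
  moreover have "deg E \<le> 1"
  proof -
    have "deg (emb c * E) \<le> 1" unfolding cE by (simp only: degree_pCons_eq_if) simp
    then show ?thesis by (simp only: deg_emb_mult)
  qed
  ultimately obtain e0 e1 where "E = [: iota e0, iota e1 :]" using B_deg_le_1 by metis
  with cE have "iota (c * e0) = iota (smult l (b * b) + (pcompose p U - smult (\<epsilon>\<^sup>2) p))"
    and "iota (c * e1) = iota (smult (l * \<epsilon>) b + smult (l * \<epsilon>) b)"
    by (simp_all add: mult_pCons_left)
  then have e0: "c * e0 = smult l (b * b) + (pcompose p U - smult (\<epsilon>\<^sup>2) p)"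
    and "c * e1 = smult (l * \<epsilon>) b + smult (l * \<epsilon>) b" by (simp_all only: iota_inj)
  then have e1: "c * e1 = smult (2 * l * \<epsilon>) b" by (simp add: ac_simps flip: smult_add_left)
  have "c dvd b" using e1 l \<epsilon>0 by (metis dvd_smult_cancel dvd_triv_left mult_eq_0_iff zero_neq_numeral)
  then have "c dvd smult l (b * b)" by (simp add: dvd_smult)
  then have "c dvd pcompose p U - smult (\<epsilon>\<^sup>2) p" using e0 by (metis dvd_add_right_iff dvd_triv_left)
  moreover have "deg (pcompose p U - smult (\<epsilon>\<^sup>2) p) < deg c"
    using deg_p by (intro degree_diff_less) (simp_all add: degree_pcompose U_def)
  ultimately have p_eq: "pcompose p U = smult (\<epsilon>\<^sup>2) p"
    using dvd_imp_degree_le[of c "pcompose p U - smult (\<epsilon>\<^sup>2) p"] by auto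
  have "cf (pcompose p U) i = \<alpha> ^ i * cf p i" for i
    by (simp add: U_def \<beta> coeff_pcompose_linear)
  then have "\<alpha> ^ i * cf p i = \<epsilon>\<^sup>2 * cf p i" for i using p_eq by (metis coeff_smult)
  from this[of 0] this[of 1] p0 p1 have "\<epsilon>\<^sup>2 = 1" "\<alpha> = 1" by simp_all
  then show ?thesis using \<open>c dvd b\<close> yy \<alpha>(2) \<beta>
    by (intro that[of b \<epsilon>]) (simp_all add: power2_eq_1_iff)
qed

section \<open>Reflections and translations do not commute with simple derivations\<close>

text \<open>An element that divides its own derivative generates a stable ideal, so it is zero or a unit.\<close>

lemma B_simple_darboux:
  assumes d: "B_derivation d" and dB: "\<And>f. f \<in> B \<Longrightarrow> d f \<in> B" and simple: "B_simple d"
    and e: "e \<in> B" "h \<in> B" "d e = e * h" "e \<noteq> 0"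
  obtains k where "e = K k"
proof -
  define I where "I = (\<lambda>g. e * g) ` B"
  have "B_ideal I" unfolding B_ideal_def
  proof (intro conjI ballI)
    show "I \<subseteq> B" using e(1) by (auto simp: I_def)
    show "0 \<in> I" unfolding I_def by (rule image_eqI[of _ _ 0]) auto
    show "f + g \<in> I" if "f \<in> I" "g \<in> I" for f g
      using that unfolding I_def by (auto simp: distrib_left[symmetric])
    show "f * g \<in> I" if "f \<in> B" "g \<in> I" for f g
      using that unfolding I_def by (auto simp: mult.left_commute[of f])
  qed
  moreover have "d ` I \<subseteq> I"
  proof
    fix f assume "f \<in> d ` I"
    then obtain g where g: "g \<in> B" "f = d (e * g)" by (auto simp: I_def)
    then have "f = e * (h * g + d g)" using e by (simp add: B_derivationD[OF d] algebra_simps)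
    then show "f \<in> I" unfolding I_def using g e dB by blast
  qed
  ultimately have "I = {0} \<or> I = B" using simple unfolding B_simple_def by blast
  moreover have "e \<in> I" unfolding I_def by (rule image_eqI[of _ _ 1]) auto
  ultimately have "1 \<in> I" using e(4) by auto
  then obtain g where "g \<in> B" "e * g = 1" unfolding I_def by auto
  then show ?thesis using B_unit[OF e(1)] that by blast
qed

text \<open>
  All differences \<open>g - s g\<close> are multiples of \<open>e = 2 y - b\<close>, because those of the generators are. As \<open>d\<close>
  commutes with \<open>s\<close> and \<open>s e = - e\<close>, this applies to \<open>2 d e = d e - s (d e)\<close>.
\<close>

lemma no_reflection:
  assumes d: "B_derivation d" and dB: "\<And>f. f \<in> B \<Longrightarrow> d f \<in> B" and simple: "B_simple d"
    and s: "B_endo s" and sx: "s xx = xx" and sy: "s yy = emb b + K (- 1) * yy" and b: "c dvd b"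
    and comm: "\<And>f. f \<in> B \<Longrightarrow> s (d f) = d (s f)"
  shows False
proof -
  note sD = B_endoD[OF s]
  obtain b' where b': "b = c * b'" using b by auto
  define e where "e = yy + yy - emb b"
  have eB: "e \<in> B" unfolding e_def by (intro B_diff B_add B_yy B_emb)
  have s_minus: "s (- f) = - s f" if "f \<in> B" for f
    using that sD(2)[of f "- f"] sD(4)[of 0] by (simp add: B_minus eq_neg_iff_add_eq_0 add.commute)
  have s_diff: "s (f - g) = s f - s g" if "f \<in> B" "g \<in> B" for f g
    using that sD(2)[of f "- g"] s_minus[of g] B_minus[of g] by simp
  have s_emb: "s (emb f) = emb f" for f using B_endo_emb[OF s sx] by simp
  have sy': "s yy = emb b - yy" by (simp add: sy mult_pCons_left)
  have se: "s e = - e" unfolding e_def by (simp only: s_diff sD B_yy B_emb B_add s_emb sy') (simp only: algebra_simps minus_diff_eq)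
  have "\<exists>h\<in>B. g - s g = e * h" if "g \<in> B" for g
    using that
  proof (induction rule: B_induct)
    case (const a)
    then show ?case by (intro bexI[of _ 0]) (simp_all add: sD)
  next
    case x
    then show ?case by (intro bexI[of _ 0]) (simp_all add: sx)
  next
    case y
    then show ?case by (intro bexI[of _ 1]) (simp_all add: sy' e_def)
  next
    case z
    have "s (emb c * zz) = s (K l * (yy * yy) + emb p)" by (simp only: surface_eq power2_eq_square)
    then have 1: "emb c * s zz = K l * ((emb b - yy) * (emb b - yy)) + emb p"
      by (simp only: sD B_K B_emb B_mult B_yy B_zz s_emb sy')
    have "emb c * (zz - s zz) = K l * emb b * e"
      unfolding right_diff_distrib 1 surface_eq e_def by (simp only: power2_eq_square) (simp only: algebra_simps)
    also have "\<dots> = emb c * (e * (K l * emb b'))"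
      by (simp add: b' mult_pCons_left ac_simps)
    finally have "zz - s zz = e * (K l * emb b')" by (simp add: mult_left_cancel)
    then show ?case by (intro bexI) auto
  next
    case (add f g)
    then obtain h h' where "h \<in> B" "h' \<in> B" "f - s f = e * h" "g - s g = e * h'" by blast
    moreover have "f + g - s (f + g) = (f - s f) + (g - s g)" using add by (simp add: sD)
    ultimately have "f + g - s (f + g) = e * (h + h')" "h + h' \<in> B" by (auto simp only: distrib_left)
    then show ?case by blast
  next
    case (mult f g)
    then obtain h h' where h: "h \<in> B" "h' \<in> B" "f - s f = e * h" "g - s g = e * h'" by blast
    have "f * g - s (f * g) = (f - s f) * g + s f * (g - s g)"
      using mult by (simp add: sD algebra_simps)
    also have "\<dots> = e * (h * g + s f * h')" by (simp only: h) (simp only: algebra_simps)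
    finally show ?case using h mult sD(1) by blast
  qed
  then obtain h where h: "h \<in> B" "d e - s (d e) = e * h" using dB[OF eB] by blast
  have "s (d e) = - d e" using comm[OF eB] B_derivation_minus[OF d eB] by (simp add: se)
  then have "d e + d e = e * h" using h by simp
  then have "K (1 / 2) * (d e + d e) = e * (K (1 / 2) * h)" by (simp add: ac_simps)
  moreover have "K (1 / 2) * (d e + d e) = (K (1 / 2) + K (1 / 2)) * d e" by (simp only: algebra_simps)
  moreover have "K (1 / 2) + K (1 / 2) = (1 :: 'k fls poly)"
    by (simp add: fls_plus_const flip: one_pCons)
  ultimately have "d e = e * (K (1 / 2) * h)" by (metis mult_1_left)
  moreover have "e = [: - iota b, 2 :]" by (simp add: e_def)
  ultimately obtain k where "e = K k" using B_simple_darboux[OF d dB simple eB, of "K (1 / 2) * h"] h by auto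
  then show False using \<open>e = [: - iota b, 2 :]\<close> by simp
qed

text \<open>
  Here \<open>s\<close> acts on polynomials in \<open>y\<close> as the substitution of \<open>y + b\<close>, whose invariants have degree 0 in \<open>y\<close> in
  characteristic zero. So \<open>d x\<close> is a polynomial in \<open>x\<close>; a root \<open>a\<close> of it would make \<open>x - a\<close> a divisor of its
  own derivative, so it is constant, and then \<open>d y\<close> can be determined from its image under \<open>s\<close>.
\<close>

lemma no_translation:
  assumes root: "\<And>f :: 'k poly. deg f > 0 \<Longrightarrow> \<exists>a. poly f a = 0"
    and d: "B_derivation d" and dB: "\<And>f. f \<in> B \<Longrightarrow> d f \<in> B" and simple: "B_simple d"
    and s: "B_endo s" and sx: "s xx = xx" and sy: "s yy = emb b + K 1 * yy" and b: "c dvd b"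
    and comm: "\<And>f. f \<in> B \<Longrightarrow> s (d f) = d (s f)"
  shows "b = 0"
proof (rule ccontr)
  assume b0: "b \<noteq> 0"
  note sD = B_endoD[OF s]
  define T where "T = [:iota b, 1:]"
  have T: "T = emb b + K 1 * yy" by (simp add: T_def mult_pCons_left)
  have s_emb: "s (emb f) = emb f" for f using B_endo_emb[OF s sx] by simp
  have yT: "pcompose yy T = T" by (simp add: pcompose_pCons mult_pCons_right)
  have s_T: "s f = pcompose f T" if "f \<in> B" for f
    using that
  proof (induction rule: B_induct)
    case z
    have "s (emb c * zz) = s (K l * (yy * yy) + emb p)" by (simp only: surface_eq power2_eq_square)
    then have "emb c * s zz = K l * (T * T) + emb p"
      by (simp only: sD B_K B_emb B_mult B_yy B_zz s_emb sy T)
    also have "\<dots> = pcompose (K l * yy\<^sup>2 + emb p) T"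
      by (simp add: pcompose_add pcompose_mult power2_eq_square yT)
    also have "\<dots> = emb c * pcompose zz T" by (simp only: surface_eq[symmetric] pcompose_mult pcompose_const)
    finally show ?case by simp
  qed (simp_all add: sD s_emb pcompose_add pcompose_mult, simp_all add: pcompose_pCons yT sx, simp add: sy T)
  have ib: "iota b \<noteq> 0" using b0 by simp

  have "pcompose (d xx) T = d xx" 
    using s_T[OF dB[OF B_emb]] comm[of xx] sx by (metis B_emb)
  then have "deg (d xx) = 0" using pcompose_translation_fixed(2)[of "d xx" "iota b" 0] ib by (simp add: T_def)
  then obtain f where f: "d xx = emb f" using B_deg_0[OF dB[OF B_emb]] by blast
  have no_root: "poly f a \<noteq> 0" for a
  proof
    assume "poly f a = 0"
    then obtain f' where f': "f = [:- a, 1:] * f'" by (metis dvdE poly_eq_0_iff_dvd)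
    have "d (emb [:- a, 1:]) = emb f" using B_derivation_emb[OF d, of "[:- a, 1:]"] f
      by (simp add: pderiv_pCons mult_pCons_left flip: one_pCons)
    also have "\<dots> = emb [:- a, 1:] * emb f'" by (simp only: f' iota_mult) (simp add: mult_pCons_left)
    finally obtain k where "emb [:- a, 1:] = K k"
      using B_simple_darboux[OF d dB simple B_emb B_emb, of "[:- a, 1:]" f'] by auto
    then have "emb [:- a, 1:] = emb [:k:]" by (simp only: K_emb)
    then show False by (simp only: pCons_eq_iff iota_inj) simp
  qed
  then have "deg f = 0" using root by blast
  then obtain f0 where f0: "f = [:f0:]" by (rule degree_eq_zeroE)
  with no_root have "f0 \<noteq> 0" by auto

  have "pcompose (d yy) T = s (d yy)" by (rule s_T[symmetric, OF dB[OF B_yy]])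
  also have "\<dots> = d (emb b + yy)" using comm[OF B_yy] by (simp add: sy mult_pCons_left)
  also have "\<dots> = d yy + emb (smult f0 (pderiv b))"
    by (simp only: B_derivationD[OF d] B_emb B_yy B_derivation_emb[OF d, of b] f f0)
      (simp add: mult_pCons_left iota_pCons ac_simps)
  finally have dy: "pcompose (d yy) T = d yy + emb (smult f0 (pderiv b))" .
  then have "deg (d yy) \<le> 1" using pcompose_translation_fixed(1)[of "d yy" "iota b"] ib by (simp add: T_def)
  then obtain g0 g1 where g: "d yy = [: iota g0, iota g1 :]" using B_deg_le_1 dB[OF B_yy] by metis
  have "iota (g1 * b) = iota (smult f0 (pderiv b))"
    using dy by (simp add: g T_def pcompose_pCons mult_pCons_left mult_pCons_right)
  then have gb: "g1 * b = smult f0 (pderiv b)" by (simp only: iota_inj)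
  have "deg b \<ge> 2" using b b0 deg_c dvd_imp_degree_le[of c b] by linarith
  then have "pderiv b \<noteq> 0" and deg': "deg (pderiv b) < deg b"
    by (simp_all add: pderiv_eq_0_iff degree_pderiv)
  then have "g1 \<noteq> 0" using gb \<open>f0 \<noteq> 0\<close> by auto
  then have "deg (g1 * b) \<ge> deg b" using b0 by (simp add: degree_mult_eq)
  then show False using gb deg' \<open>f0 \<noteq> 0\<close> by simp
qed

theorem commuting_automorphism_trivial:
  assumes root: "\<And>f :: 'k poly. deg f > 0 \<Longrightarrow> \<exists>a. poly f a = 0"
    and d: "B_derivation d" and dB: "\<And>f. f \<in> B \<Longrightarrow> d f \<in> B" and simple: "B_simple d"
    and st: "B_inverse s t"
    and comm: "\<And>f. f \<in> B \<Longrightarrow> s (d f) = d (s f)"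
    and f: "f \<in> B"
  shows "s f = f"
proof -
  have s: "B_endo s" and t: "B_endo t" and inv: "\<And>f. f \<in> B \<Longrightarrow> s (t f) = f" "\<And>f. f \<in> B \<Longrightarrow> t (s f) = f"
    using st by (auto simp: B_inverse_def)
  note sD = B_endoD[OF s] and tD = B_endoD[OF t]
  obtain \<alpha> \<beta> \<gamma> where unit: "\<alpha> \<in> B" "\<beta> \<in> B" "\<gamma> \<in> B" "1 = \<alpha> * emb c + \<beta> * yy + \<gamma> * rr"
    using jacobian_unit_ideal[OF d dB simple] by blast
  obtain k where k: "k \<noteq> 0" "\<And>f g. f \<in> B \<Longrightarrow> g \<in> B \<Longrightarrow> s (br (t f) (t g)) = K k * br f g"
    using automorphism_scales_bracket[OF s t inv unit] by blast
  obtain k' where k': "k' \<noteq> 0" "\<And>f g. f \<in> B \<Longrightarrow> g \<in> B \<Longrightarrow> t (br (s f) (s g)) = K k' * br f g"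
    using automorphism_scales_bracket[OF t s inv(2,1) unit] by blast
  have sk: "scales_bracket s k" unfolding scales_bracket_def
    using k(2) by (metis inv(2) sD(1))
  have tk: "scales_bracket t k'" unfolding scales_bracket_def
    using k'(2) by (metis inv(1) tD(1))
  obtain a b where ab: "a \<noteq> 0" "s xx = emb [:b, a:]"
    using image_of_x_affine[OF st k(1) sk k'(1) tk] by blast
  obtain b \<epsilon> where form: "s xx = xx" "s yy = emb b + K \<epsilon> * yy" "c dvd b" "\<epsilon> = 1 \<or> \<epsilon> = - 1"
    using automorphism_form[OF s k(1) sk ab] by blast
  have "\<epsilon> \<noteq> - 1" using no_reflection[OF d dB simple s form(1) _ form(3) comm] form(2) by auto
  then have \<epsilon>: "\<epsilon> = 1" using form(4) by simp
  then have "b = 0" using no_translation[OF root d dB simple s form(1) _ form(3) comm] form(2) by simp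
  then have sy: "s yy = yy" using form(2) \<epsilon> by (simp add: mult_pCons_left)
  have s_emb: "s (emb f) = emb f" for f using B_endo_emb[OF s form(1)] by simp
  have "s (emb c * zz) = s (K l * (yy * yy) + emb p)" by (simp only: surface_eq power2_eq_square)
  then have "emb c * s zz = emb c * zz"
    by (simp only: sD B_K B_emb B_mult B_yy B_zz s_emb sy) (simp only: surface_eq power2_eq_square)
  then have sz: "s zz = zz" by simp
  show ?thesis using f
    by (induction rule: B_induct) (simp_all add: sD form(1) sy sz)
qed

end

section \<open>The coordinate ring as a quotient\<close>

context surface
begin

text \<open>
  The evaluation of \<open>k[x][y][z]\<close> in \<open>k((1/x))[y]\<close>, one variable after the other; \<open>xz_lift\<close> below is the inclusion of
  \<open>k[x][z]\<close> into \<open>k[x][y][z]\<close>.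
\<close>

definition bipoly_map :: "'k poly poly \<Rightarrow> 'k fls poly" where
  "bipoly_map = map_poly iota"

lemma bipoly_map_0 [simp]: "bipoly_map 0 = 0" by (simp add: bipoly_map_def)
lemma bipoly_map_pCons: "bipoly_map (pCons a g) = emb a + yy * bipoly_map g"
  by (simp add: bipoly_map_def map_poly_pCons mult_pCons_left)
lemma bipoly_map_add: "bipoly_map (f + g) = bipoly_map f + bipoly_map g"
  by (induction f g rule: poly_induct2) (simp_all add: bipoly_map_pCons algebra_simps)
lemma bipoly_map_smult: "bipoly_map (smult a f) = emb a * bipoly_map f"
  by (induction f) (simp_all add: bipoly_map_pCons algebra_simps, simp add: mult_pCons_left)
lemma bipoly_map_mult: "bipoly_map (f * g) = bipoly_map f * bipoly_map g"
proof (induction f)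
  case (pCons a f)
  have "bipoly_map (pCons a f * g) = bipoly_map (smult a g + pCons 0 (f * g))" by (simp only: mult_pCons_left)
  then show ?case
    using pCons.IH by (simp add: bipoly_map_pCons bipoly_map_add bipoly_map_smult algebra_simps)
qed simp

definition tripoly_map :: "'k poly poly poly \<Rightarrow> 'k fls poly" where
  "tripoly_map f = poly (map_poly bipoly_map f) zz"

lemma tripoly_map_0 [simp]: "tripoly_map 0 = 0" by (simp add: tripoly_map_def)
lemma tripoly_map_pCons: "tripoly_map (pCons a g) = bipoly_map a + zz * tripoly_map g"
  by (simp add: tripoly_map_def map_poly_pCons)
lemma tripoly_map_add: "tripoly_map (f + g) = tripoly_map f + tripoly_map g"
  by (induction f g rule: poly_induct2) (simp_all add: tripoly_map_pCons bipoly_map_add algebra_simps)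
lemma tripoly_map_smult: "tripoly_map (smult a f) = bipoly_map a * tripoly_map f"
  by (induction f) (simp_all add: tripoly_map_pCons bipoly_map_mult algebra_simps)
lemma tripoly_map_mult: "tripoly_map (f * g) = tripoly_map f * tripoly_map g"
proof (induction f)
  case (pCons a f)
  have "tripoly_map (pCons a f * g) = tripoly_map (smult a g + pCons 0 (f * g))" by (simp only: mult_pCons_left)
  then show ?case
    using pCons.IH by (simp add: tripoly_map_pCons tripoly_map_add tripoly_map_smult algebra_simps)
qed simp

definition surface_poly :: "'k poly poly poly" where
  "surface_poly = [:[:c:]:] * [:0, 1:] - [:[:[:l:]:] * [:0, 1:]\<^sup>2 + [:p:]:]"

lemma bipoly_map_const [simp]: "bipoly_map [:a:] = emb a" by (simp add: bipoly_map_pCons)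
lemma tripoly_map_const [simp]: "tripoly_map [:a:] = bipoly_map a" by (simp add: tripoly_map_pCons)
lemma tripoly_map_y: "bipoly_map [:0, 1:] = yy"
  by (simp add: bipoly_map_pCons one_pCons iota_pCons)
lemma tripoly_map_z: "tripoly_map [:0, 1:] = zz"
  by (simp add: tripoly_map_pCons one_pCons iota_pCons)

lemma tripoly_map_surface_poly: "tripoly_map surface_poly = 0"
proof -
  have "tripoly_map (surface_poly + [:[:[:l:]:] * [:0, 1:]\<^sup>2 + [:p:]:]) = emb c * zz"
    unfolding surface_poly_def by (simp add: tripoly_map_mult tripoly_map_z)
  moreover have "tripoly_map [:[:[:l:]:] * [:0, 1:]\<^sup>2 + [:p:]:] = emb c * zz"
    unfolding surface_eq tripoly_map_const power2_eq_square bipoly_map_add bipoly_map_mult tripoly_map_y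
    by (simp add: K_emb)
  ultimately show ?thesis by (simp only: tripoly_map_add) simp
qed

lemma tripoly_map_B: "tripoly_map f \<in> B"
proof (induction f)
  case (pCons a f)
  have "bipoly_map a \<in> B" by (induction a) (auto simp: bipoly_map_pCons)
  then show ?case using pCons by (auto simp: tripoly_map_pCons)
qed auto

definition xz_lift :: "'k poly poly \<Rightarrow> 'k poly poly poly" where
  "xz_lift g = map_poly (\<lambda>a. [:a:]) g"

lemma xz_lift_0 [simp]: "xz_lift 0 = 0" by (simp add: xz_lift_def)
lemma xz_lift_pCons: "xz_lift (pCons a g) = [:[:a:]:] + [:0, 1:] * xz_lift g"
  by (simp add: xz_lift_def map_poly_pCons mult_pCons_left)
lemma xz_lift_add: "xz_lift (f + g) = xz_lift f + xz_lift g"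
  by (induction f g rule: poly_induct2) (simp_all add: xz_lift_pCons algebra_simps)
lemma xz_lift_smult: "xz_lift (smult a f) = [:[:a:]:] * xz_lift f"
  by (induction f) (simp_all add: xz_lift_pCons algebra_simps, simp add: mult_pCons_left)
lemma xz_lift_mult: "xz_lift (f * g) = xz_lift f * xz_lift g"
proof (induction f)
  case (pCons a f)
  have "xz_lift (pCons a f * g) = xz_lift (smult a g + pCons 0 (f * g))" by (simp only: mult_pCons_left)
  then show ?case
    using pCons.IH by (simp add: xz_lift_pCons xz_lift_add xz_lift_smult algebra_simps)
qed simp

lemma tripoly_map_xz_lift: "tripoly_map (xz_lift g) = ev g"
  by (induction g) (simp_all add: xz_lift_pCons ev_pCons tripoly_map_add tripoly_map_mult tripoly_map_z)

text \<open>Division with remainder by the defining polynomial, read as a quadratic polynomial in \<open>y\<close>.\<close>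

lemma normal_form_mod_surface_poly:
  "\<exists>g h. surface_poly dvd f - (xz_lift g + xz_lift h * [:[:0, 1:]:])"
proof -
  let ?y = "[:[:0, 1:]:] :: 'k poly poly poly"
  define M where "M = {f. \<exists>g h. surface_poly dvd f - (xz_lift g + xz_lift h * ?y)}"
  have const: "[:[:a:]:] \<in> M" for a
    unfolding M_def by (intro CollectI exI[of _ "[:a:]"] exI[of _ 0]) (simp add: xz_lift_pCons)
  have y: "?y \<in> M"
    unfolding M_def by (intro CollectI exI[of _ 0] exI[of _ 1]) (simp add: one_pCons xz_lift_pCons mult_pCons_left)
  have z: "[:0, 1:] \<in> M"
    unfolding M_def by (intro CollectI exI[of _ "[:0, 1:]"] exI[of _ 0]) (simp add: one_pCons xz_lift_pCons mult_pCons_left)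
  have add: "f + f' \<in> M" if ff: "f \<in> M" "f' \<in> M" for f f'
  proof -
    obtain g h g' h' where *: "surface_poly dvd f - (xz_lift g + xz_lift h * ?y)"
      "surface_poly dvd f' - (xz_lift g' + xz_lift h' * ?y)" using ff unfolding M_def by blast
    have "(f + f') - (xz_lift (g + g') + xz_lift (h + h') * ?y)
      = (f - (xz_lift g + xz_lift h * ?y)) + (f' - (xz_lift g' + xz_lift h' * ?y))"
      by (simp only: xz_lift_add) (simp only: algebra_simps)
    then have "surface_poly dvd (f + f') - (xz_lift (g + g') + xz_lift (h + h') * ?y)"
      using * by (metis dvd_add)
    then show ?thesis unfolding M_def by blast
  qed
  define Q where "Q = [: - smult (1 / l) p, smult (1 / l) c :]"
  have Q: "xz_lift Q - ?y * ?y = [:[:[:1 / l:]:]:] * surface_poly"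
    unfolding Q_def surface_poly_def power2_eq_square using l
    by (simp add: xz_lift_pCons mult_pCons_left mult_pCons_right one_pCons)
  have mult: "f * f' \<in> M" if ff: "f \<in> M" "f' \<in> M" for f f'
  proof -
    obtain g h g' h' where *: "surface_poly dvd f - (xz_lift g + xz_lift h * ?y)" (is "_ dvd f - ?r")
      "surface_poly dvd f' - (xz_lift g' + xz_lift h' * ?y)" (is "_ dvd f' - ?r'")
      using ff unfolding M_def by blast
    have "f * f' - (xz_lift (g * g' + h * h' * Q) + xz_lift (g * h' + h * g') * ?y)
      = (f - ?r) * f' + ?r * (f' - ?r') - xz_lift h * xz_lift h' * (xz_lift Q - ?y * ?y)"
      by (simp only: xz_lift_add xz_lift_mult) (simp only: algebra_simps)
    also have "surface_poly dvd \<dots>"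
      unfolding Q by (intro dvd_diff dvd_add dvd_mult2 dvd_mult * dvd_refl)
    finally show ?thesis unfolding M_def by blast
  qed
  have "[:a:] \<in> M" for a
  proof (induction a)
    case (pCons b a)
    have "[:pCons b a:] = [:[:b:]:] + ?y * [:a:]" by (simp add: mult_pCons_left)
    then show ?case using pCons const y add mult by metis
  qed (use const[of 0] in simp)
  then have "f \<in> M"
  proof (induction f)
    case (pCons a f)
    have "pCons a f = [:a:] + [:0, 1:] * f" by (simp add: mult_pCons_left)
    then show ?case using pCons z add mult by metis
  qed (use const[of 0] in simp)
  then show ?thesis unfolding M_def by blast
qed

text \<open>
  A remainder \<open>g(x, z) + h(x, z) y\<close> is mapped to a normal form, and normal forms are unique.
\<close>

lemma tripoly_map_eq_0_iff: "tripoly_map f = 0 \<longleftrightarrow> surface_poly dvd f"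
proof
  assume f: "tripoly_map f = 0"
  obtain g h where gh: "surface_poly dvd f - (xz_lift g + xz_lift h * [:[:0, 1:]:])"
    using normal_form_mod_surface_poly by blast
  then obtain k where "f - (xz_lift g + xz_lift h * [:[:0, 1:]:]) = surface_poly * k" by (rule dvdE)
  then have "f = surface_poly * k + (xz_lift g + xz_lift h * [:[:0, 1:]:])" by (simp add: algebra_simps)
  then have "tripoly_map f = ev g + ev h * yy"
    by (simp only: tripoly_map_add tripoly_map_mult tripoly_map_surface_poly tripoly_map_xz_lift
      tripoly_map_const tripoly_map_y mult_zero_left add_0_left)
  then have "g = 0 \<and> h = 0" using f normal_form_unique by simp
  then show "surface_poly dvd f" using gh by simp
next
  assume "surface_poly dvd f"
  then show "tripoly_map f = 0" by (auto simp: tripoly_map_mult tripoly_map_surface_poly)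
qed

lemma range_tripoly_map: "range tripoly_map = B"
proof
  show "B \<subseteq> range tripoly_map"
  proof
    fix f assume "f \<in> B"
    then obtain g h where "f = ev g + ev h * yy" by (auto simp: B_def)
    then have "f = tripoly_map (xz_lift g + xz_lift h * [:[:0, 1:]:])"
      by (simp only: tripoly_map_add tripoly_map_mult tripoly_map_xz_lift tripoly_map_const tripoly_map_y)
    then show "f \<in> range tripoly_map" by blast
  qed
qed (use tripoly_map_B in auto)

lemma coordinate_ring_iso:
  defines "A \<equiv> danielewski c ([:[:l:]:] * [:0, 1:]\<^sup>2 + [:p:])"
    and "\<phi> \<equiv> danielewski_const c ([:[:l:]:] * [:0, 1:]\<^sup>2 + [:p:])"
  obtains E where "bij_betw E (carrier A) B"
    and "\<And>f g. f \<in> carrier A \<Longrightarrow> g \<in> carrier A \<Longrightarrow> E (f \<oplus>\<^bsub>A\<^esub> g) = E f + E g"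
    and "\<And>f g. f \<in> carrier A \<Longrightarrow> g \<in> carrier A \<Longrightarrow> E (f \<otimes>\<^bsub>A\<^esub> g) = E f * E g"
    and "\<And>a. E (\<phi> a) = K a"
proof -
  let ?P = "poly3_ring :: 'k poly poly poly ring" and ?R = "ring_of_type_algebra :: 'k fls poly ring"
  define I where "I = danielewski_ideal c ([:[:l:]:] * [:0, 1:]\<^sup>2 + [:p:])"
  have P: "carrier ?P = UNIV" "\<And>f g. f \<otimes>\<^bsub>?P\<^esub> g = f * g" "\<And>f g. f \<oplus>\<^bsub>?P\<^esub> g = f + g" "\<one>\<^bsub>?P\<^esub> = 1"
    and R: "carrier ?R = UNIV" "\<And>f g. f \<otimes>\<^bsub>?R\<^esub> g = f * g" "\<And>f g. f \<oplus>\<^bsub>?R\<^esub> g = f + g" "\<one>\<^bsub>?R\<^esub> = 1" "\<zero>\<^bsub>?R\<^esub> = 0"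
    by (simp_all add: ring_of_type_algebra_def)
  have t1: "tripoly_map 1 = 1" using tripoly_map_const[of 1] bipoly_map_const[of 1] by (simp flip: one_pCons)
  interpret h: ring_hom_ring ?P ?R tripoly_map
    by (rule ring_hom_ringI[OF ring_from_type_algebra ring_from_type_algebra])
      (simp_all add: P R tripoly_map_add tripoly_map_mult t1)
  have "I = PIdl\<^bsub>?P\<^esub> surface_poly"
    unfolding I_def danielewski_ideal_def surface_poly_def
    by (rule cring.cgenideal_eq_genideal[OF cring_from_type_algebra, symmetric]) (simp add: P)
  then have I: "I = {f. surface_poly dvd f}"
    unfolding cgenideal_def P dvd_def by (auto simp: mult.commute)
  then have kernel: "a_kernel ?P ?R tripoly_map = I"
    unfolding a_kernel_def' P R tripoly_map_eq_0_iff by auto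
  define E where "E = (\<lambda>T. the_elem (tripoly_map ` T))"
  have "E \<in> ring_iso (?P Quot I) (?R \<lparr> carrier := B \<rparr>)"
    using h.FactRing_iso_set_aux by (simp add: kernel E_def P range_tripoly_map)
  then have iso: "E \<in> ring_iso A (?R \<lparr> carrier := B \<rparr>)" by (simp add: A_def danielewski_def I_def)
  have "E (\<phi> a) = K a" for a
  proof -
    have "\<phi> a = (\<lambda>i. i + [:[:[:a:]:]:]) ` I"
      unfolding \<phi>_def danielewski_const_def I_def[symmetric] a_r_coset_def' P
      by (simp only: image_def Bex_def) blast
    then have "tripoly_map ` \<phi> a = (\<lambda>i. tripoly_map (i + [:[:[:a:]:]:])) ` I"
      by (simp only: image_image)
    also have "\<dots> = (\<lambda>i. K a) ` I"
    proof (rule image_cong[OF refl])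
      fix i assume "i \<in> I"
      then have "tripoly_map i = 0" by (simp only: I tripoly_map_eq_0_iff mem_Collect_eq)
      then show "tripoly_map (i + [:[:[:a:]:]:]) = K a"
        by (simp only: tripoly_map_add tripoly_map_const bipoly_map_const K_emb add_0_left)
    qed
    also have "\<dots> = {K a}"
    proof -
      have "0 \<in> I" by (simp only: I mem_Collect_eq dvd_0_right)
      then show ?thesis by (rule image_constant)
    qed
    finally show ?thesis by (simp only: E_def the_elem_eq)
  qed
  moreover have "bij_betw E (carrier A) B" using iso by (simp add: ring_iso_def)
  moreover have "E (f \<oplus>\<^bsub>A\<^esub> g) = E f + E g" "E (f \<otimes>\<^bsub>A\<^esub> g) = E f * E g"
    if "f \<in> carrier A" "g \<in> carrier A" for f g
  proof -
    have "E \<in> ring_hom A (?R \<lparr> carrier := B \<rparr>)" using iso by (simp add: ring_iso_def)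
    from ring_hom_add[OF this that] ring_hom_mult[OF this that] show
      "E (f \<oplus>\<^bsub>A\<^esub> g) = E f + E g" "E (f \<otimes>\<^bsub>A\<^esub> g) = E f * E g" by (simp_all add: R)
  qed
  ultimately show ?thesis by - (rule that)
qed

end

section \<open>Transport to the quotient ring\<close>

theorem theorem19:
  fixes c p :: "'k::{alg_closed_field, field_char_0} poly"
    and q :: "'k poly poly" and l :: 'k and n :: nat
    and D :: "'k poly poly poly set \<Rightarrow> 'k poly poly poly set"
  assumes "n \<ge> 2"
    and "Polynomial.degree c = n" and "centered c"
    and "l \<noteq> 0" and "Polynomial.degree p \<le> n - 1"
    and "q = [:[:l:]:] * [:0, 1:]^2 + [:p:]"
    and "poly.coeff p 0 * poly.coeff p 1 \<noteq> 0"
    and "D \<in> derivations (danielewski_const c q) (danielewski c q)"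
    and "simple_derivation (danielewski c q) D"
  shows "derivation_auts (danielewski_const c q) (danielewski c q) D
    = {\<lambda>f\<in>carrier (danielewski c q). f}"
proof -
  interpret rigid_surface c p l
    using assms(1-5,7) by unfold_locales (auto simp: centered_def)
  define A \<phi> where "A = danielewski c q" and "\<phi> = danielewski_const c q"
  interpret A: cring A unfolding A_def by (rule cring_danielewski)
  have \<phi>_carrier: "\<phi> a \<in> carrier A" for a
    using ring_hom_closed[OF danielewski_const_hom, of a c q]
    by (simp add: A_def \<phi>_def ring_of_type_algebra_def)
  obtain E where bij: "bij_betw E (carrier A) B"
    and E_add: "\<And>f g. f \<in> carrier A \<Longrightarrow> g \<in> carrier A \<Longrightarrow> E (f \<oplus>\<^bsub>A\<^esub> g) = E f + E g"
    and E_mult: "\<And>f g. f \<in> carrier A \<Longrightarrow> g \<in> carrier A \<Longrightarrow> E (f \<otimes>\<^bsub>A\<^esub> g) = E f * E g"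
    and E_\<phi>: "\<And>a. E (\<phi> a) = K a"
    using coordinate_ring_iso unfolding A_def \<phi>_def assms(6) by blast
  \<comment> \<open>\<open>E\<close> and its inverse \<open>G\<close> carry \<open>D\<close> and the automorphisms over to \<open>B\<close>\<close>
  define G where "G = inv_into (carrier A) E"
  have G: "G b \<in> carrier A" "E (G b) = b" if "b \<in> B" for b
    using that bij unfolding G_def bij_betw_def by (auto intro: inv_into_into f_inv_into_f)
  have GE: "G (E f) = f" if "f \<in> carrier A" for f
    using that bij unfolding G_def bij_betw_def by (auto intro: inv_into_f_f)
  have E_B: "E f \<in> B" if "f \<in> carrier A" for f using bij that by (auto simp: bij_betw_def)
  have E_inj: "f = g" if "E f = E g" "f \<in> carrier A" "g \<in> carrier A" for f g
    using GE that by metis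
  have E_0: "E \<zero>\<^bsub>A\<^esub> = 0" using E_add[of "\<zero>\<^bsub>A\<^esub>" "\<zero>\<^bsub>A\<^esub>"] by simp
  have G_add: "G (b + b') = G b \<oplus>\<^bsub>A\<^esub> G b'" and G_mult: "G (b * b') = G b \<otimes>\<^bsub>A\<^esub> G b'"
    if "b \<in> B" "b' \<in> B" for b b'
    using that by - (rule E_inj; simp add: G E_add E_mult B_add B_mult)+
  have G_K: "G (K a) = \<phi> a" for a using GE[OF \<phi>_carrier] by (simp add: E_\<phi>)

  have D: "\<And>f. f \<in> carrier A \<Longrightarrow> D f \<in> carrier A"
    "\<And>f g. f \<in> carrier A \<Longrightarrow> g \<in> carrier A \<Longrightarrow> D (f \<oplus>\<^bsub>A\<^esub> g) = D f \<oplus>\<^bsub>A\<^esub> D g"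
    "\<And>a f. f \<in> carrier A \<Longrightarrow> D (\<phi> a \<otimes>\<^bsub>A\<^esub> f) = \<phi> a \<otimes>\<^bsub>A\<^esub> D f"
    "\<And>f g. f \<in> carrier A \<Longrightarrow> g \<in> carrier A \<Longrightarrow>
      D (f \<otimes>\<^bsub>A\<^esub> g) = D f \<otimes>\<^bsub>A\<^esub> g \<oplus>\<^bsub>A\<^esub> f \<otimes>\<^bsub>A\<^esub> D g"
    using assms(8) unfolding derivations_def A_def \<phi>_def by auto
  define d where "d = (\<lambda>b. E (D (G b)))"
  have dB: "d b \<in> B" if "b \<in> B" for b using that by (simp add: d_def E_B D G)
  have d_add: "d (b + b') = d b + d b'" and d_mult: "d (b * b') = d b * b' + b * d b'"
    if "b \<in> B" "b' \<in> B" for b b'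
    using that by (simp_all add: d_def G G_add G_mult D E_add E_mult)
  have "d 1 = 0" using d_mult[of 1 1] by simp
  moreover have "d (K a * b) = K a * d b" if "b \<in> B" for a b
    using that by (simp add: d_def G G_mult G_K D(1,3) E_mult E_\<phi> \<phi>_carrier)
  from this[of 1] have "d (K a) = K a * d 1" for a by simp
  ultimately have d: "B_derivation d" by (simp add: B_derivation_def d_add d_mult)

  have simple: "B_simple d"
    unfolding B_simple_def
  proof (intro allI impI)
    fix I assume I: "B_ideal I \<and> d ` I \<subseteq> I"
    then have I_B: "I \<subseteq> B" and I0: "0 \<in> I" and I_add: "\<And>f g. f \<in> I \<Longrightarrow> g \<in> I \<Longrightarrow> f + g \<in> I"
      and I_mult: "\<And>f g. f \<in> B \<Longrightarrow> g \<in> I \<Longrightarrow> f * g \<in> I" and I_d: "\<And>f. f \<in> I \<Longrightarrow> d f \<in> I"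
      by (auto simp: B_ideal_def)
    define H where "H = {f \<in> carrier A. E f \<in> I}"
    have "ideal H A"
    proof (rule idealI[OF A.ring_axioms])
      show "subgroup H (add_monoid A)"
      proof (rule A.add.subgroupI)
        show "H \<noteq> {}" using I0 E_0 unfolding H_def by auto
        fix f assume f: "f \<in> H"
        then have "E f + E (\<ominus>\<^bsub>A\<^esub> f) = 0"
          using E_add[of f "\<ominus>\<^bsub>A\<^esub> f"] E_0 by (simp add: H_def A.r_neg)
        then have "E (\<ominus>\<^bsub>A\<^esub> f) = - 1 * E f" by (simp add: add_eq_0_iff2)
        then show "\<ominus>\<^bsub>A\<^esub> f \<in> H" using f I_mult[of "- 1" "E f"] B_minus[OF B_1] by (simp add: H_def)
      qed (auto simp: H_def E_add I_add)
    next
      fix f g assume fg: "f \<in> H" "g \<in> carrier A"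
      then show "g \<otimes>\<^bsub>A\<^esub> f \<in> H" by (simp add: H_def E_mult E_B I_mult)
      with fg show "f \<otimes>\<^bsub>A\<^esub> g \<in> H" by (simp add: H_def A.m_comm)
    qed
    moreover have "D ` H \<subseteq> H"
    proof (rule image_subsetI)
      fix f assume "f \<in> H"
      then have f: "f \<in> carrier A" "E f \<in> I" by (simp_all add: H_def)
      then show "D f \<in> H" using I_d[OF f(2)] by (simp add: H_def D(1) d_def GE)
    qed
    ultimately have "H = {\<zero>\<^bsub>A\<^esub>} \<or> H = carrier A"
      using assms(9) unfolding simple_derivation_def A_def by blast
    moreover have "I = E ` H"
    proof
      show "I \<subseteq> E ` H"
      proof
        fix b assume "b \<in> I"
        then have "G b \<in> carrier A" "E (G b) = b" using G[of b] I_B by blast+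
        then have "G b \<in> H" "b = E (G b)" using \<open>b \<in> I\<close> by (simp_all add: H_def)
        then show "b \<in> E ` H" by (rule rev_image_eqI)
      qed
    qed (auto simp: H_def)
    moreover have "E ` carrier A = B" using bij by (simp add: bij_betw_def)
    ultimately show "I = {0} \<or> I = B" using E_0 by (metis image_empty image_insert)
  qed

  have "\<sigma> = (\<lambda>f\<in>carrier A. f)" if "\<sigma> \<in> derivation_auts \<phi> A D" for \<sigma>
  proof -
    have iso: "\<sigma> \<in> ring_iso A A" and ext: "\<sigma> \<in> extensional (carrier A)" and \<sigma>_\<phi>: "\<And>a. \<sigma> (\<phi> a) = \<phi> a"
      and comm: "compose (carrier A) \<sigma> D = compose (carrier A) D \<sigma>"
      using that by (auto simp: derivation_auts_def algebra_auts_def)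
    have hom: "\<sigma> \<in> ring_hom A A" and \<sigma>_bij: "bij_betw \<sigma> (carrier A) (carrier A)"
      using iso by (auto simp: ring_iso_def)
    define \<tau> where "\<tau> = inv_into (carrier A) \<sigma>"
    have \<sigma>_closed: "\<sigma> f \<in> carrier A" if "f \<in> carrier A" for f using ring_hom_closed[OF hom that] .
    have \<tau>: "\<tau> f \<in> carrier A" "\<sigma> (\<tau> f) = f" "\<tau> (\<sigma> f) = f" if "f \<in> carrier A" for f
      using that \<sigma>_bij unfolding \<tau>_def bij_betw_def
      by (simp_all add: inv_into_into f_inv_into_f inv_into_f_f)
    have \<sigma>_inj: "f = g" if "\<sigma> f = \<sigma> g" "f \<in> carrier A" "g \<in> carrier A" for f g
      using \<tau>(3) that by metis
    have \<tau>_hom: "\<tau> (f \<oplus>\<^bsub>A\<^esub> g) = \<tau> f \<oplus>\<^bsub>A\<^esub> \<tau> g" "\<tau> (f \<otimes>\<^bsub>A\<^esub> g) = \<tau> f \<otimes>\<^bsub>A\<^esub> \<tau> g"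
      if "f \<in> carrier A" "g \<in> carrier A" for f g
      using that by - (rule \<sigma>_inj; simp add: \<tau> ring_hom_add[OF hom] ring_hom_mult[OF hom])+
    have \<tau>_\<phi>: "\<tau> (\<phi> a) = \<phi> a" for a using \<tau>(3)[OF \<phi>_carrier, of a] by (simp add: \<sigma>_\<phi>)
    define s t where "s = (\<lambda>b. E (\<sigma> (G b)))" and "t = (\<lambda>b. E (\<tau> (G b)))"
    have st: "B_inverse s t"
      unfolding B_inverse_def B_endo_def s_def t_def
      by (auto simp: G GE E_B \<sigma>_closed \<tau> G_add G_mult G_K E_add E_mult E_\<phi> \<sigma>_\<phi> \<tau>_\<phi> \<tau>_hom
        ring_hom_add[OF hom] ring_hom_mult[OF hom])
    have "s (d b) = d (s b)" if "b \<in> B" for b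
    proof -
      have "\<sigma> (D (G b)) = D (\<sigma> (G b))"
        using fun_cong[OF comm, of "G b"] G(1)[OF that] by (simp add: compose_eq)
      then show ?thesis using that by (simp add: s_def d_def GE D G \<sigma>_closed)
    qed
    then have "s b = b" if "b \<in> B" for b
      using commuting_automorphism_trivial[OF alg_closed_imp_poly_has_root d dB simple st _ that] by blast
    then have "\<sigma> f = f" if "f \<in> carrier A" for f
      using that GE E_B \<sigma>_closed E_inj unfolding s_def by metis
    then show ?thesis using ext by (intro extensionalityI[OF ext restrict_extensional]) simp
  qed
  moreover have "(\<lambda>f\<in>carrier A. f) \<in> derivation_auts \<phi> A D"
  proof -
    have "(\<lambda>f\<in>carrier A. f) \<in> ring_iso A A"
      by (rule ring_iso_memI) (auto simp: bij_betw_def inj_on_def)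
    then show ?thesis
      using D(1) \<phi>_carrier
      by (auto simp: derivation_auts_def algebra_auts_def compose_def intro!: restrict_ext)
  qed
  ultimately show ?thesis unfolding A_def \<phi>_def by blast
qed

end
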